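(* Let $U$ be a ground set, $k\ge1$, $\mathcal{A}_{\le k}=\{A\subseteq U:|A|\le k\}$, and consider the distributionally robust 2-stage problem $\min_{x\in X}h_{\hat p}(x)$ whose central distribution $\hat p$ has polynomial-size support contained in $\mathcal{A}_{\le k}$. Consider the two settings: (B1) $\mathcal{A}=\mathcal{A}_{\le k}$ and $\kappa_{sc}$ is the discrete metric ($\kappa_{sc}(A,A')=1$ if $A\ne A'$, $0$ otherwise); (B2) $\mathcal{A}=2^U$ and $\kappa_{sc}(A,A)=0$ for all $A$, while for $A\ne A'$, $\kappa_{sc}(A,A')=1$ if $|A|,|A'|\le k$ and $\kappa_{sc}(A,A')=Z$ otherwise, where $Z/2$ is an upper bound on $g(0,U)$. Assume that $g(0,\emptyset)=0$, that the problem $(\Pi)$: $\max_{A\subseteq U,|A|\le k}g(0,A)$ is NP-hard, and that the optimum value of $(\Pi)$ is at least $1$. Then, assuming P $\ne$ NP, in both settings: (a) no polynomial-time multiplicative approximation is possible for computing $g(0,y,\emptyset)$ given $y\ge0$ as input; (b) for a suitable choice of $\hat p$, no polynomial-time multiplicative approximation is possible for computing $\mathbb{E}_{A\sim\hat p}[g(0,y,A)]$ given $y\ge0$ as input; (c) one can choose $r$ and $\hat p$ so that the problem of computing $z_{\hat p}(0)$ is at least as hard as $(\Pi)$.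
   Context: $g(x,A)\ge0$ is the optimal (fractional) second-stage cost of scenario $A$ given first-stage decision $x$; $0$ denotes the zero first-stage decision. $r>0$ is a radius. For $y\ge0$ and $A\in\mathcal{A}$, $g(x,y,A)=\max_{A'\in\mathcal{A}}(g(x,A')-y\kappa_{sc}(A,A'))$. For $\hat p$ with support $\mathcal{A}_{sup}$, $z_{\hat p}(x)=\max\{\sum_{(A,A')\in\mathcal{A}_{sup}\times\mathcal{A}}\gamma_{A,A'}g(x,A'):\gamma\ge0,\ \sum_{A'}\gamma_{A,A'}\le\hat p_A\ \forall A,\ \sum_{A,A'}\kappa_{sc}(A,A')\gamma_{A,A'}\le r\}$ and $h_{\hat p}(x)=c^\top x+z_{\hat p}(x)$.
   Formalization: Two conditions are added, without which the claim can fail: the values g(0,A) for |A|≤k are rationals of polynomial encoding length, and in (B2) U is a costliest scenario, i.e. g(0,A)≤g(0,U) for all A⊆U. *)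

theory Defs
  imports "HOL-Probability.Probability" "HOL-Computational_Algebra.Polynomial"
begin

section \<open>Polynomial time, P and NP\<close>

text \<open>
  Deterministic multi-tape Turing machines over the tape alphabet
  blank (\<open>None\<close>), 0 and 1 (\<open>Some False\<close>, \<open>Some True\<close>). A tape is two-way infinite and is stored
  relative to its head: cell 0 is the scanned cell, and moving the head shifts the tape. The states
  are the numbers below \<open>nstates\<close>; 0 is the initial state and every number from \<open>nstates\<close> on is a
  halting state. As only states below \<open>nstates\<close> and read-lists of length \<open>ntapes\<close> are ever
  consulted, the transition table is finite.
\<close>

datatype dir = Left | Stay | Right

type_synonym tape = "int \<Rightarrow> bool option"

record tm =
  ntapes :: nat
  nstates :: nat
  delta :: "nat \<Rightarrow> bool option list \<Rightarrow> nat \<times> (bool option \<times> dir) list"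

definition tm_wf :: "tm \<Rightarrow> bool" where
  "tm_wf M \<longleftrightarrow> 1 \<le> ntapes M \<and>
     (\<forall>q rs. q < nstates M \<and> length rs = ntapes M \<longrightarrow> length (snd (delta M q rs)) = ntapes M)"

fun move :: "dir \<Rightarrow> tape \<Rightarrow> tape" where
  "move Left t = (\<lambda>i. t (i - 1))"
| "move Stay t = t"
| "move Right t = (\<lambda>i. t (i + 1))"

definition act :: "tape \<Rightarrow> bool option \<times> dir \<Rightarrow> tape" where
  "act t a = move (snd a) (t(0 := fst a))"

definition tm_step :: "tm \<Rightarrow> nat \<times> tape list \<Rightarrow> nat \<times> tape list" where
  "tm_step M c = (case c of (q, ts) \<Rightarrow>
     if nstates M \<le> q then (q, ts)
     else (case delta M q (map (\<lambda>t. t 0) ts) of (q', as) \<Rightarrow> (q', map2 act ts as)))"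

definition blank_tape :: tape where
  "blank_tape = (\<lambda>i. None)"

definition tape_of :: "bool list \<Rightarrow> tape" where
  "tape_of x = (\<lambda>i. if 0 \<le> i \<and> nat i < length x then Some (x ! nat i) else None)"

definition tm_init :: "tm \<Rightarrow> bool list \<Rightarrow> nat \<times> tape list" where
  "tm_init M x = (0, tape_of x # replicate (ntapes M - 1) blank_tape)"

text \<open>The first tape carries the input and, on halting, exactly the output.\<close>

definition tm_outputs :: "tm \<Rightarrow> bool list \<Rightarrow> nat \<Rightarrow> bool list \<Rightarrow> bool" where
  "tm_outputs M x n y \<longleftrightarrow>
     (case (tm_step M ^^ n) (tm_init M x) of (q, ts) \<Rightarrow> nstates M \<le> q \<and> hd ts = tape_of y)"

text \<open>Outside the promise \<open>S\<close> the machine may behave arbitrarily.\<close>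

definition polytime_on :: "bool list set \<Rightarrow> (bool list \<Rightarrow> bool list) \<Rightarrow> bool" where
  "polytime_on S f \<longleftrightarrow> (\<exists>M (p :: nat poly). tm_wf M \<and>
     (\<forall>x\<in>S. \<exists>n \<le> poly p (length x). tm_outputs M x n (f x)))"

text \<open>Self-delimiting code of a list of bit strings: each bit is preceded by 1, each string is
  closed by 0.\<close>

definition enc_list :: "bool list list \<Rightarrow> bool list" where
  "enc_list xs = concat (map (\<lambda>x. concat (map (\<lambda>b. [True, b]) x) @ [False]) xs)"

definition class_P :: "bool list set set" where
  "class_P = {A. polytime_on UNIV (\<lambda>x. [x \<in> A])}"

definition class_NP :: "bool list set set" where
  "class_NP = {A. \<exists>V\<in>class_P. \<exists>p :: nat poly.
     \<forall>x. x \<in> A \<longleftrightarrow> (\<exists>c. length c \<le> poly p (length x) \<and> enc_list [x, c] \<in> V)}"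

text \<open>NP-hardness (under polynomial-time many-one reductions) of the decision problem whose yes- and
  no-instances are \<open>Yes\<close> and \<open>No\<close>; strings outside both sets are not instances.\<close>

definition NP_hard :: "bool list set \<Rightarrow> bool list set \<Rightarrow> bool" where
  "NP_hard Yes No \<longleftrightarrow> (\<forall>A\<in>class_NP. \<exists>f. polytime_on UNIV f \<and>
     (\<forall>x. (x \<in> A \<longrightarrow> f x \<in> Yes) \<and> (x \<notin> A \<longrightarrow> f x \<in> No)))"


section \<open>Problems of computing a number\<close>

text \<open>Numbers are fractions of two binary numerals, least significant bit first. Neither leading
  zeros nor common factors are excluded.\<close>

definition nat_of_bits :: "bool list \<Rightarrow> nat" where
  "nat_of_bits bs = horner_sum of_bool 2 bs"

definition is_frac :: "bool list \<Rightarrow> bool list \<Rightarrow> bool" where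
  "is_frac u v \<longleftrightarrow> 0 < nat_of_bits v"

definition frac_val :: "bool list \<Rightarrow> bool list \<Rightarrow> real" where
  "frac_val u v = real (nat_of_bits u) / real (nat_of_bits v)"

record 'i eval_problem =
  insts :: "'i set"
  code :: "'i \<Rightarrow> bool list"
  val :: "'i \<Rightarrow> real"

text \<open>A multiplicative approximation may have any finite factor, even one depending on the
  instance, and may err on either side.\<close>

definition approximable :: "'i eval_problem \<Rightarrow> bool" where
  "approximable Q \<longleftrightarrow> (\<exists>f. polytime_on (code Q ` insts Q) f \<and>
     (\<exists>\<alpha> :: 'i \<Rightarrow> real. \<forall>i\<in>insts Q. 1 \<le> \<alpha> i \<and>
        (\<exists>u v. f (code Q i) = enc_list [u, v] \<and> is_frac u v \<and>
           val Q i / \<alpha> i \<le> frac_val u v \<and> frac_val u v \<le> \<alpha> i * val Q i)))"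

text \<open>\<open>Q\<close> is at least as hard as \<open>P\<close>: a polynomial-time map takes instances of \<open>P\<close> to instances of
  \<open>Q\<close> with the same value.\<close>

definition at_least_as_hard :: "'j eval_problem \<Rightarrow> 'i eval_problem \<Rightarrow> bool" where
  "at_least_as_hard Q P \<longleftrightarrow> (\<exists>f. polytime_on (code P ` insts P) f \<and>
     (\<forall>i\<in>insts P. \<exists>j\<in>insts Q. f (code P i) = code Q j \<and> val Q j = val P i))"


section \<open>Distributionally robust two-stage problems\<close>

record two_stage =
  ground :: "nat set"                              (* U *)
  card_bound :: nat                                (* k *)
  first_dim :: nat
  first_cost :: "nat \<Rightarrow> real"                      (* c *)
  decisions :: "(nat \<Rightarrow> real) set"                 (* X *)
  recourse :: "(nat \<Rightarrow> real) \<Rightarrow> nat set \<Rightarrow> real"    (* g(x,A) *)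

abbreviation zero_decision :: "nat \<Rightarrow> real" where
  "zero_decision \<equiv> (\<lambda>i. 0)"

definition small_scenarios :: "two_stage \<Rightarrow> nat set set" where
  "small_scenarios I = {A. A \<subseteq> ground I \<and> card A \<le> card_bound I}"

datatype setting = B1 | B2

fun scenarios :: "setting \<Rightarrow> two_stage \<Rightarrow> nat set set" where
  "scenarios B1 I = small_scenarios I"
| "scenarios B2 I = Pow (ground I)"

fun sc_metric :: "setting \<Rightarrow> two_stage \<Rightarrow> real \<Rightarrow> nat set \<Rightarrow> nat set \<Rightarrow> real" where
  "sc_metric B1 I Z A A' = (if A \<noteq> A' then 1 else 0)"
| "sc_metric B2 I Z A A' =
     (if A = A' then 0 else if card A \<le> card_bound I \<and> card A' \<le> card_bound I then 1 else Z)"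

text \<open>\<open>g(x,y,A)\<close>\<close>

definition penalized ::
  "two_stage \<Rightarrow> nat set set \<Rightarrow> (nat set \<Rightarrow> nat set \<Rightarrow> real) \<Rightarrow> (nat \<Rightarrow> real) \<Rightarrow> real \<Rightarrow> nat set \<Rightarrow> real"
  where "penalized I \<A> \<kappa> x y A = Max ((\<lambda>A'. recourse I x A' - y * \<kappa> A A') ` \<A>)"

definition transport_plans ::
  "nat set set \<Rightarrow> (nat set \<Rightarrow> nat set \<Rightarrow> real) \<Rightarrow> nat set pmf \<Rightarrow> real \<Rightarrow> (nat set \<Rightarrow> nat set \<Rightarrow> real) set"
  where "transport_plans \<A> \<kappa> p r = {\<gamma>.
     (\<forall>A\<in>set_pmf p. \<forall>A'\<in>\<A>. 0 \<le> \<gamma> A A') \<and>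
     (\<forall>A\<in>set_pmf p. (\<Sum>A'\<in>\<A>. \<gamma> A A') \<le> pmf p A) \<and>
     (\<Sum>A\<in>set_pmf p. \<Sum>A'\<in>\<A>. \<kappa> A A' * \<gamma> A A') \<le> r}"

text \<open>\<open>z\<close> and \<open>h\<close>; for finite \<open>\<A>\<close> and finite support the supremum is over a compact polytope of
  (restricted) plans and hence a maximum.\<close>

definition worst_case ::
  "two_stage \<Rightarrow> nat set set \<Rightarrow> (nat set \<Rightarrow> nat set \<Rightarrow> real) \<Rightarrow> nat set pmf \<Rightarrow> real \<Rightarrow> (nat \<Rightarrow> real) \<Rightarrow> real"
  where "worst_case I \<A> \<kappa> p r x =
     (SUP \<gamma> \<in> transport_plans \<A> \<kappa> p r. \<Sum>A\<in>set_pmf p. \<Sum>A'\<in>\<A>. \<gamma> A A' * recourse I x A')"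

definition dr_objective ::
  "two_stage \<Rightarrow> nat set set \<Rightarrow> (nat set \<Rightarrow> nat set \<Rightarrow> real) \<Rightarrow> nat set pmf \<Rightarrow> real \<Rightarrow> (nat \<Rightarrow> real) \<Rightarrow> real"
  where "dr_objective I \<A> \<kappa> p r x = (\<Sum>i<first_dim I. first_cost I i * x i) + worst_case I \<A> \<kappa> p r x"

definition opt_Pi :: "two_stage \<Rightarrow> real" where
  "opt_Pi I = Max (recourse I zero_decision ` small_scenarios I)"


text \<open>A central distribution is given to an algorithm as an explicit list of scenarios (lists of
  elements in binary) with their probabilities.\<close>

type_synonym dist_list = "(bool list list \<times> bool list \<times> bool list) list"

definition dist_table :: "dist_list \<Rightarrow> (nat set \<times> real) list" where
  "dist_table ps = map (\<lambda>(E, u, v). (nat_of_bits ` set E, frac_val u v)) ps"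

definition central_dist :: "dist_list \<Rightarrow> nat set pmf" where
  "central_dist ps = pmf_of_list (dist_table ps)"

definition enc_dist :: "dist_list \<Rightarrow> bool list" where
  "enc_dist ps = enc_list (map (\<lambda>(E, u, v). enc_list [enc_list E, u, v]) ps)"

text \<open>A class of two-stage problems is a set \<open>D\<close> of bit strings with the instance \<open>inst w\<close> described by
  each \<open>w \<in> D\<close>. Polynomial size is measured in the length of \<open>w\<close>.\<close>

definition valid_central ::
  "bool list set \<Rightarrow> (bool list \<Rightarrow> two_stage) \<Rightarrow> (bool list \<Rightarrow> dist_list) \<Rightarrow> bool" where
  "valid_central D inst ps \<longleftrightarrow>
     (\<forall>w\<in>D. (\<forall>(E, u, v)\<in>set (ps w). is_frac u v) \<and> pmf_of_list_wf (dist_table (ps w)) \<and>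
        set_pmf (central_dist (ps w)) \<subseteq> small_scenarios (inst w)) \<and>
     (\<exists>q :: nat poly. \<forall>w\<in>D. length (enc_dist (ps w)) \<le> poly q (length w))"

definition poly_size_values :: "bool list set \<Rightarrow> (bool list \<Rightarrow> two_stage) \<Rightarrow> bool" where
  "poly_size_values D inst \<longleftrightarrow> (\<exists>q :: nat poly. \<forall>w\<in>D. \<forall>A\<in>small_scenarios (inst w).
     \<exists>u v. is_frac u v \<and> recourse (inst w) zero_decision A = frac_val u v \<and>
           length u + length v \<le> poly q (length w))"

text \<open>NP-hardness of the maximization problem is that of its decision version: given an
  instance and a rational threshold, is the optimum at least the threshold?\<close>

definition Pi_yes :: "bool list set \<Rightarrow> (bool list \<Rightarrow> two_stage) \<Rightarrow> bool list set" where
  "Pi_yes D inst = {enc_list [w, u, v] | w u v.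
     w \<in> D \<and> is_frac u v \<and> opt_Pi (inst w) \<ge> frac_val u v}"

definition Pi_no :: "bool list set \<Rightarrow> (bool list \<Rightarrow> two_stage) \<Rightarrow> bool list set" where
  "Pi_no D inst = {enc_list [w, u, v] | w u v.
     w \<in> D \<and> is_frac u v \<and> \<not> opt_Pi (inst w) \<ge> frac_val u v}"

definition Pi_problem :: "bool list set \<Rightarrow> (bool list \<Rightarrow> two_stage) \<Rightarrow> bool list eval_problem" where
  "Pi_problem D inst = \<lparr>insts = D, code = (\<lambda>w. w), val = (\<lambda>w. opt_Pi (inst w))\<rparr>"

definition penalized_problem ::
  "setting \<Rightarrow> bool list set \<Rightarrow> (bool list \<Rightarrow> two_stage) \<Rightarrow> (bool list \<Rightarrow> real) \<Rightarrow>
   (bool list \<times> bool list \<times> bool list) eval_problem" where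
  "penalized_problem s D inst Z =
     \<lparr>insts = {(w, u, v). w \<in> D \<and> is_frac u v},
      code = (\<lambda>(w, u, v). enc_list [w, u, v]),
      val = (\<lambda>(w, u, v). penalized (inst w) (scenarios s (inst w)) (sc_metric s (inst w) (Z w))
                            zero_decision (frac_val u v) {})\<rparr>"

definition expectation_problem ::
  "setting \<Rightarrow> bool list set \<Rightarrow> (bool list \<Rightarrow> two_stage) \<Rightarrow> (bool list \<Rightarrow> real) \<Rightarrow>
   (bool list \<Rightarrow> dist_list) \<Rightarrow> (bool list \<times> bool list \<times> bool list) eval_problem" where
  "expectation_problem s D inst Z ps =
     \<lparr>insts = {(w, u, v). w \<in> D \<and> is_frac u v},
      code = (\<lambda>(w, u, v). enc_list [enc_dist (ps w), w, u, v]),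
      val = (\<lambda>(w, u, v). measure_pmf.expectation (central_dist (ps w))
               (penalized (inst w) (scenarios s (inst w)) (sc_metric s (inst w) (Z w))
                  zero_decision (frac_val u v)))\<rparr>"

definition worst_case_problem ::
  "setting \<Rightarrow> bool list set \<Rightarrow> (bool list \<Rightarrow> two_stage) \<Rightarrow> (bool list \<Rightarrow> real) \<Rightarrow>
   (bool list \<Rightarrow> dist_list) \<Rightarrow> (bool list \<Rightarrow> bool list \<times> bool list) \<Rightarrow> bool list eval_problem" where
  "worst_case_problem s D inst Z ps r =
     \<lparr>insts = D,
      code = (\<lambda>w. enc_list [enc_dist (ps w), fst (r w), snd (r w), w]),
      val = (\<lambda>w. worst_case (inst w) (scenarios s (inst w)) (sc_metric s (inst w) (Z w))
                   (central_dist (ps w)) (frac_val (fst (r w)) (snd (r w))) zero_decision)\<rparr>"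

end

theory Submission
  imports Defs
begin

text \<open>
  Let the central distribution be concentrated on the empty scenario. In both settings
  \<open>g(0,y,{})\<close> is nonnegative, and it is positive iff \<open>y\<close> is less than the optimum of \<open>\<Pi>\<close>: in the
  second setting, a scenario with more than \<open>k\<close> elements contributes at most \<open>Z/2 - y Z\<close>, which is
  positive only if \<open>y < 1/2\<close>. A multiplicative approximation, whatever its factor, tells zero
  from positive values and thus decides \<open>y < opt\<close>. As the optimum is a fraction of polynomial
  size, the question \<open>u/v \<le> opt\<close> is equivalent to \<open>u M / (v M + 1) < opt\<close> for a sufficiently
  large power \<open>M\<close> of two with polynomially many bits. The decision version of \<open>\<Pi>\<close> would therefore
  be in P. Moreover, for radius \<open>1\<close> the worst case \<open>z(0)\<close> is the optimum of \<open>\<Pi>\<close>, because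
  \<open>g(0,A) \<le> opt \<cdot> \<kappa>({},A)\<close> for all scenarios \<open>A\<close>.
\<close>

subsection \<open>Runs of Turing machines\<close>

text \<open>The factor of an approximation is unrestricted and may vary with the instance, so only
  the sign of an answer carries information. This yields a strict comparison with the optimum,
  whereas the decision version asks a non-strict one; the polynomial size of the values is what
  makes a small perturbation of the threshold bridge the gap. Polynomial time refers to concrete
  multi-tape machines, so the perturbation has to be programmed: multiplying by \<open>M\<close>
  means inserting zero bits below a numeral, adding 1 to a multiple of \<open>M\<close> means
  setting its lowest bit, and the number of zeros comes from squaring a unary counter a fixed number
  of times. The rest is composition of functions, each trusted only on its promise set.\<close>

fun reaches :: "tm \<Rightarrow> nat \<Rightarrow> nat \<times> tape list \<Rightarrow> nat \<times> tape list \<Rightarrow> bool" where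
  "reaches M 0 c c' \<longleftrightarrow> c = c'"
| "reaches M (Suc n) c c' \<longleftrightarrow> fst c < nstates M \<and> reaches M n (tm_step M c) c'"

lemma reaches_trans: "reaches M m a b \<Longrightarrow> reaches M n b c \<Longrightarrow> reaches M (m + n) a c"
  by (induction m arbitrary: a) auto

lemma reaches_funpow: "reaches M n c c' \<Longrightarrow> (tm_step M ^^ n) c = c'"
  by (induction n arbitrary: c) (auto simp: funpow_swap1)

lemma tm_step_halted: "nstates M \<le> fst c \<Longrightarrow> tm_step M c = c"
  by (auto simp: tm_step_def split: prod.splits)

lemma funpow_halted: "nstates M \<le> fst c \<Longrightarrow> (tm_step M ^^ n) c = c"
  by (induction n) (auto simp: tm_step_halted)

text \<open>A halted machine idles under \<open>tm_step\<close>. Such idle steps would not survive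
  the redirection of halting states in a larger machine, so they are discarded here:
  \<open>reaches\<close> counts only steps taken while running.\<close>

lemma funpow_reaches:
  "nstates M \<le> fst ((tm_step M ^^ n) c) \<Longrightarrow> \<exists>m\<le>n. reaches M m c ((tm_step M ^^ n) c)"
proof (induction n arbitrary: c)
  case (Suc n)
  show ?case
  proof (cases "nstates M \<le> fst c")
    case True
    then show ?thesis using funpow_halted[of M c "Suc n"] by (intro exI[of _ 0]) simp
  next
    case False
    from Suc.IH[of "tm_step M c"] Suc.prems obtain m where
      "m \<le> n" "reaches M m (tm_step M c) ((tm_step M ^^ Suc n) c)"
      by (auto simp: funpow_swap1)
    then show ?thesis using False by (intro exI[of _ "Suc m"]) auto
  qed
qed simp

lemma tm_step_running:
  "q < nstates M \<Longrightarrow> tm_step M (q, ts) =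
     (fst (delta M q (map (\<lambda>t. t 0) ts)), map2 act ts (snd (delta M q (map (\<lambda>t. t 0) ts))))"
  by (auto simp: tm_step_def split: prod.splits)

lemma length_tm_step:
  assumes "tm_wf M" "length ts = ntapes M"
  shows "length (snd (tm_step M (q, ts))) = ntapes M"
  using assms by (cases "nstates M \<le> q") (auto simp: tm_step_halted tm_step_running tm_wf_def)

text \<open>The single simulation argument behind all combinators. \<open>\<phi>\<close> has to
  respect transitions from running states only and need not be injective, so that all halting states
  can be merged into one exit.\<close>

lemma reaches_relocate:
  assumes "\<And>q rs. q < nstates M \<Longrightarrow> \<phi> q < nstates M' \<and>
             delta M' (\<phi> q) rs = (\<phi> (fst (delta M q rs)), snd (delta M q rs))"
    and "reaches M n (q, ts) (q', ts')"
  shows "reaches M' n (\<phi> q, ts) (\<phi> q', ts')"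
  using assms(2)
proof (induction n arbitrary: q ts)
  case (Suc n)
  then show ?case using assms(1)[of q] by (auto simp: tm_step_running)
qed simp

definition runs :: "tm \<Rightarrow> tape list \<Rightarrow> nat \<Rightarrow> tape list \<Rightarrow> bool" where
  "runs M ts t ts' \<longleftrightarrow> (\<exists>n\<le>t. \<exists>q\<ge>nstates M. reaches M n (0, ts) (q, ts'))"

lemma ex_tm_outputs_iff_runs:
  "(\<exists>n\<le>t. tm_outputs M x n y) \<longleftrightarrow> (\<exists>ts. runs M (snd (tm_init M x)) t ts \<and> hd ts = tape_of y)"
proof
  assume "\<exists>n\<le>t. tm_outputs M x n y"
  then obtain n q ts where n: "n \<le> t" "(tm_step M ^^ n) (tm_init M x) = (q, ts)"
    "nstates M \<le> q" "hd ts = tape_of y"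
    by (force simp: tm_outputs_def)
  then obtain m where "m \<le> n" "reaches M m (tm_init M x) (q, ts)"
    using funpow_reaches[of M n "tm_init M x"] by auto
  then show "\<exists>ts. runs M (snd (tm_init M x)) t ts \<and> hd ts = tape_of y"
    using n unfolding runs_def
    by (intro exI[of _ ts] conjI exI[of _ m] exI[of _ q]) (auto simp: tm_init_def)
next
  assume "\<exists>ts. runs M (snd (tm_init M x)) t ts \<and> hd ts = tape_of y"
  then show "\<exists>n\<le>t. tm_outputs M x n y"
    by (auto simp: runs_def tm_outputs_def tm_init_def dest!: reaches_funpow)
qed

lemma polytime_on_iff_runs:
  "polytime_on S f \<longleftrightarrow> (\<exists>M p. tm_wf M \<and>
     (\<forall>x\<in>S. \<exists>ts. runs M (snd (tm_init M x)) (poly p (length x)) ts \<and> hd ts = tape_of (f x)))"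
  by (simp add: polytime_on_def ex_tm_outputs_iff_runs)

lemma polytime_on_cong:
  "polytime_on S f \<Longrightarrow> (\<And>x. x \<in> S \<Longrightarrow> f x = g x) \<Longrightarrow> polytime_on S g"
  by (auto simp: polytime_on_def)

lemma polytime_on_subset: "polytime_on T f \<Longrightarrow> S \<subseteq> T \<Longrightarrow> polytime_on S f"
  unfolding polytime_on_def by (meson subsetD)

lemma runs_mono: "runs M ts t ts' \<Longrightarrow> t \<le> t' \<Longrightarrow> runs M ts t' ts'"
  by (auto simp: runs_def intro: order_trans)


subsection \<open>Combining machines\<close>

text \<open>\<open>min\<close> merges all halting states of \<open>M\<close> into
  \<open>nstates M\<close>, which is the shifted initial state of \<open>N\<close>.\<close>

definition seq_tm :: "tm \<Rightarrow> tm \<Rightarrow> tm" (infixr ";;" 60) where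
  "M ;; N = \<lparr>ntapes = ntapes M, nstates = nstates M + nstates N,
     delta = (\<lambda>q rs. if q < nstates M
        then (min (fst (delta M q rs)) (nstates M), snd (delta M q rs))
        else (nstates M + fst (delta N (q - nstates M) rs), snd (delta N (q - nstates M) rs)))\<rparr>"

definition keep :: "bool option list \<Rightarrow> (bool option \<times> dir) list" where
  "keep rs = map (\<lambda>r. (r, Stay)) rs"

text \<open>Halting states of a component are redirected by \<open>exit_to\<close>, which also covers machines without
  any running state.\<close>

definition exit_to :: "nat \<Rightarrow> nat \<Rightarrow> nat \<Rightarrow> nat" where
  "exit_to n e q = (if q < n then Suc q else e)"

definition if_tm :: "nat \<Rightarrow> (bool option \<Rightarrow> bool) \<Rightarrow> tm \<Rightarrow> tm \<Rightarrow> tm" where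
  "if_tm i P M N = \<lparr>ntapes = ntapes M, nstates = 1 + nstates M + nstates N,
     delta = (\<lambda>q rs.
        if q = 0 then (if P (rs ! i) then exit_to (nstates M) (1 + nstates M + nstates N) 0
                       else 1 + nstates M, keep rs)
        else if q \<le> nstates M
        then (exit_to (nstates M) (1 + nstates M + nstates N) (fst (delta M (q - 1) rs)),
              snd (delta M (q - 1) rs))
        else (1 + nstates M + fst (delta N (q - (1 + nstates M)) rs),
              snd (delta N (q - (1 + nstates M)) rs)))\<rparr>"

definition while_tm :: "nat \<Rightarrow> (bool option \<Rightarrow> bool) \<Rightarrow> tm \<Rightarrow> tm" where
  "while_tm i P M = \<lparr>ntapes = ntapes M, nstates = 1 + nstates M,
     delta = (\<lambda>q rs.
        if q = 0 then (if P (rs ! i) then exit_to (nstates M) 0 0 else 1 + nstates M, keep rs)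
        else (exit_to (nstates M) 0 (fst (delta M (q - 1) rs)), snd (delta M (q - 1) rs)))\<rparr>"

lemma length_keep [simp]: "length (keep rs) = length rs"
  by (simp add: keep_def)

lemma act_keep [simp]: "act t (t 0, Stay) = t"
  by (simp add: act_def)

lemma map2_act_keep [simp]: "map2 act ts (keep (map (\<lambda>t. t 0) ts)) = ts"
  by (rule nth_equalityI) (auto simp: keep_def)

lemma ntapes_seq [simp]: "ntapes (M ;; N) = ntapes M"
  by (simp add: seq_tm_def)

lemma ntapes_if [simp]: "ntapes (if_tm i P M N) = ntapes M"
  by (simp add: if_tm_def)

lemma ntapes_while [simp]: "ntapes (while_tm i P M) = ntapes M"
  by (simp add: while_tm_def)

lemma tm_wf_seq [simp]: "tm_wf M \<Longrightarrow> tm_wf N \<Longrightarrow> ntapes N = ntapes M \<Longrightarrow> tm_wf (M ;; N)"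
  by (auto simp: tm_wf_def seq_tm_def)

lemma tm_wf_if [simp]: "tm_wf M \<Longrightarrow> tm_wf N \<Longrightarrow> ntapes N = ntapes M \<Longrightarrow> tm_wf (if_tm i P M N)"
  by (auto simp: tm_wf_def if_tm_def)

lemma tm_wf_while [simp]: "tm_wf M \<Longrightarrow> tm_wf (while_tm i P M)"
  by (auto simp: tm_wf_def while_tm_def)

lemma runs_seq:
  assumes "runs M ts a ts'" "runs N ts' b ts''"
  shows "runs (M ;; N) ts (a + b) ts''"
proof -
  from assms obtain m q n q' where
    m: "m \<le> a" "nstates M \<le> q" "reaches M m (0, ts) (q, ts')" and
    n: "n \<le> b" "nstates N \<le> q'" "reaches N n (0, ts') (q', ts'')"
    by (auto simp: runs_def)
  have "reaches (M ;; N) m (min 0 (nstates M), ts) (min q (nstates M), ts')"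
    by (rule reaches_relocate[OF _ m(3)]) (auto simp: seq_tm_def)
  moreover have "reaches (M ;; N) n (nstates M + 0, ts') (nstates M + q', ts'')"
    by (rule reaches_relocate[OF _ n(3)]) (auto simp: seq_tm_def)
  ultimately have "reaches (M ;; N) (m + n) (0, ts) (nstates M + q', ts'')"
    using m(2) by (intro reaches_trans) (auto simp: min_absorb2)
  then show ?thesis
    using m n unfolding runs_def
    by (intro exI[of _ "m + n"] exI[of _ "nstates M + q'"] conjI) (auto simp: seq_tm_def)
qed

lemma runs_if_True:
  assumes "runs M ts t ts'" "i < length ts" "P ((ts ! i) 0)"
  shows "runs (if_tm i P M N) ts (Suc t) ts'"
proof -
  from assms obtain n q where n: "n \<le> t" "nstates M \<le> q" "reaches M n (0, ts) (q, ts')"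
    by (auto simp: runs_def)
  let ?e = "exit_to (nstates M) (1 + nstates M + nstates N)"
  have "reaches (if_tm i P M N) n (?e 0, ts) (?e q, ts')"
    by (rule reaches_relocate[OF _ n(3)]) (auto simp: if_tm_def exit_to_def)
  then have "reaches (if_tm i P M N) (Suc n) (0, ts) (?e q, ts')"
    using assms by (simp add: tm_step_def if_tm_def)
  then show ?thesis
    using n unfolding runs_def
    by (intro exI[of _ "Suc n"] exI[of _ "?e q"] conjI) (auto simp: if_tm_def exit_to_def)
qed

lemma runs_if_False:
  assumes "runs N ts t ts'" "i < length ts" "\<not> P ((ts ! i) 0)"
  shows "runs (if_tm i P M N) ts (Suc t) ts'"
proof -
  from assms obtain n q where n: "n \<le> t" "nstates N \<le> q" "reaches N n (0, ts) (q, ts')"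
    by (auto simp: runs_def)
  let ?e = "\<lambda>q. 1 + nstates M + q"
  have "reaches (if_tm i P M N) n (?e 0, ts) (?e q, ts')"
    by (rule reaches_relocate[OF _ n(3)]) (auto simp: if_tm_def)
  then have "reaches (if_tm i P M N) (Suc n) (0, ts) (?e q, ts')"
    using assms by (simp add: tm_step_def if_tm_def)
  then show ?thesis
    using n unfolding runs_def
    by (intro exI[of _ "Suc n"] exI[of _ "?e q"] conjI) (auto simp: if_tm_def)
qed

lemma runs_while_False:
  assumes "i < length ts" "\<not> P ((ts ! i) 0)"
  shows "runs (while_tm i P M) ts 1 ts"
  using assms unfolding runs_def
  by (intro exI[of _ 1] exI[of _ "1 + nstates M"]) (auto simp: tm_step_def while_tm_def)

lemma runs_while_True:
  assumes "runs M ts a ts'" "runs (while_tm i P M) ts' b ts''" "i < length ts" "P ((ts ! i) 0)"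
  shows "runs (while_tm i P M) ts (Suc (a + b)) ts''"
proof -
  from assms obtain m q n q' where
    m: "m \<le> a" "nstates M \<le> q" "reaches M m (0, ts) (q, ts')" and
    n: "n \<le> b" "nstates (while_tm i P M) \<le> q'" "reaches (while_tm i P M) n (0, ts') (q', ts'')"
    by (auto simp: runs_def)
  let ?e = "exit_to (nstates M) 0"
  have "reaches (while_tm i P M) m (?e 0, ts) (?e q, ts')"
    by (rule reaches_relocate[OF _ m(3)]) (auto simp: while_tm_def exit_to_def)
  then have "reaches (while_tm i P M) (Suc m) (0, ts) (0, ts')"
    using assms m(2) by (simp add: tm_step_def while_tm_def exit_to_def)
  from reaches_trans[OF this n(3)] show ?thesis
    using m n unfolding runs_def
    by (intro exI[of _ "Suc m + n"] exI[of _ q'] conjI) auto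
qed


subsection \<open>Composition of polynomial-time functions\<close>

text \<open>\<open>lift_tm e k M\<close> runs \<open>M\<close> on the tapes \<open>e 0, e 1, \<dots>\<close> among \<open>k\<close> tapes.\<close>

definition lift_tm :: "(nat \<Rightarrow> nat) \<Rightarrow> nat \<Rightarrow> tm \<Rightarrow> tm" where
  "lift_tm e k M = \<lparr>ntapes = k, nstates = nstates M,
     delta = (\<lambda>q rs. let d = delta M q (map (\<lambda>m. rs ! e m) [0..<ntapes M]) in
        (fst d, map (\<lambda>j. if j \<in> e ` {..<ntapes M} then snd d ! inv_into {..<ntapes M} e j
                         else (rs ! j, Stay)) [0..<k]))\<rparr>"

definition put_tapes :: "(nat \<Rightarrow> nat) \<Rightarrow> tape list \<Rightarrow> tape list \<Rightarrow> tape list" where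
  "put_tapes e us ts = map (\<lambda>j. if j \<in> e ` {..<length ts} then ts ! inv_into {..<length ts} e j
                                else us ! j) [0..<length us]"

lemma length_put_tapes [simp]: "length (put_tapes e us ts) = length us"
  by (simp add: put_tapes_def)

lemma put_tapes_nth:
  "inj_on e {..<length ts} \<Longrightarrow> m < length ts \<Longrightarrow> e m < length us \<Longrightarrow> put_tapes e us ts ! e m = ts ! m"
  by (simp add: put_tapes_def)

lemma put_tapes_other:
  "j \<notin> e ` {..<length ts} \<Longrightarrow> j < length us \<Longrightarrow> put_tapes e us ts ! j = us ! j"
  by (simp add: put_tapes_def)

lemma ntapes_lift [simp]: "ntapes (lift_tm e k M) = k"
  by (simp add: lift_tm_def)

lemma tm_wf_lift [simp]: "1 \<le> k \<Longrightarrow> tm_wf (lift_tm e k M)"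
  by (simp add: tm_wf_def lift_tm_def Let_def)

text \<open>Injectivity of \<open>e\<close> lets \<open>inv_into\<close> recover the number of a
  tape of \<open>M\<close>; every other tape writes back the symbol it reads and stays, so
  \<open>us\<close> survives outside the image of \<open>e\<close>.\<close>

lemma tm_step_lift:
  assumes wf: "tm_wf M" and len: "length ts = ntapes M"
    and inj: "inj_on e {..<ntapes M}" and e: "e ` {..<ntapes M} \<subseteq> {..<length us}"
    and q: "q < nstates M"
  shows "tm_step (lift_tm e (length us) M) (q, put_tapes e us ts) =
    (fst (tm_step M (q, ts)), put_tapes e us (snd (tm_step M (q, ts))))"
proof -
  have reads: "map (\<lambda>m. map (\<lambda>t. t 0) (put_tapes e us ts) ! e m) [0..<ntapes M] =
      map (\<lambda>t. t 0) ts"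
    using assms by (intro nth_equalityI) (auto simp: put_tapes_nth)
  define d where "d = delta M q (map (\<lambda>t. t 0) ts)"
  have ld: "length (snd d) = ntapes M"
    using wf q len by (simp add: tm_wf_def d_def)
  have "map2 act (put_tapes e us ts)
      (map (\<lambda>j. if j \<in> e ` {..<ntapes M} then snd d ! inv_into {..<ntapes M} e j
                else (map (\<lambda>t. t 0) (put_tapes e us ts) ! j, Stay)) [0..<length us]) =
    put_tapes e us (map2 act ts (snd d))"
  proof (rule nth_equalityI)
    fix j assume "j < length (map2 act (put_tapes e us ts)
      (map (\<lambda>j. if j \<in> e ` {..<ntapes M} then snd d ! inv_into {..<ntapes M} e j
                else (map (\<lambda>t. t 0) (put_tapes e us ts) ! j, Stay)) [0..<length us]))"
    then have j: "j < length us" by simp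
    show "map2 act (put_tapes e us ts)
      (map (\<lambda>j. if j \<in> e ` {..<ntapes M} then snd d ! inv_into {..<ntapes M} e j
                else (map (\<lambda>t. t 0) (put_tapes e us ts) ! j, Stay)) [0..<length us]) ! j =
      put_tapes e us (map2 act ts (snd d)) ! j"
    proof (cases "j \<in> e ` {..<ntapes M}")
      case True
      then obtain m where m: "m < ntapes M" "j = e m" by auto
      then show ?thesis using j len inj ld by (simp add: put_tapes_nth)
    next
      case False
      then show ?thesis using j len ld by (simp add: put_tapes_other)
    qed
  qed simp
  then show ?thesis
    using q by (simp add: tm_step_running lift_tm_def Let_def reads cong: if_cong flip: d_def)
qed

lemma reaches_lift:
  assumes wf: "tm_wf M" and len: "length ts = ntapes M"
    and inj: "inj_on e {..<ntapes M}" and e: "e ` {..<ntapes M} \<subseteq> {..<length us}"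
    and "reaches M n (q, ts) (q', ts')"
  shows "reaches (lift_tm e (length us) M) n (q, put_tapes e us ts) (q', put_tapes e us ts')"
  using len assms(5)
proof (induction n arbitrary: q ts)
  case (Suc n)
  obtain q1 ts1 where 1: "tm_step M (q, ts) = (q1, ts1)" by force
  have q: "q < nstates M" using Suc.prems by simp
  have "length ts1 = ntapes M" using length_tm_step[OF wf Suc.prems(1), of q] 1 by simp
  from Suc.IH[OF this, of q1] have
    "reaches (lift_tm e (length us) M) n (q1, put_tapes e us ts1) (q', put_tapes e us ts')"
    using Suc.prems 1 by simp
  then show ?case
    using q tm_step_lift[OF wf Suc.prems(1) inj e q] 1 by (simp add: lift_tm_def)
qed simp

lemma runs_lift:
  assumes "tm_wf M" "length ts = ntapes M" "inj_on e {..<ntapes M}"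
    "e ` {..<ntapes M} \<subseteq> {..<length us}" "runs M ts t ts'"
  shows "runs (lift_tm e (length us) M) (put_tapes e us ts) t (put_tapes e us ts')"
proof -
  from assms(5) obtain n q where
    "n \<le> t" "nstates M \<le> q" "reaches M n (0, ts) (q, ts')" by (auto simp: runs_def)
  then show ?thesis using reaches_lift[OF assms(1-4)] unfolding runs_def
    by (intro exI[of _ n] exI[of _ q]) (auto simp: lift_tm_def)
qed

section \<open>Invariants of runs: the number of tapes and the length of the output\<close>

lemma runs_length:
  assumes "tm_wf M" "length ts = ntapes M" "runs M ts t ts'"
  shows "length ts' = ntapes M"
proof -
  have "length ts' = ntapes M" if "reaches M n (q, ts) (q', ts')" for n q q'
    using assms(2) that
  proof (induction n arbitrary: q ts)
    case (Suc n)
    then show ?case using length_tm_step[OF assms(1) Suc.prems(1), of q]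
      by (cases "tm_step M (q, ts)") auto
  qed simp
  then show ?thesis using assms(3) by (auto simp: runs_def)
qed

text \<open>Up to translation this set does not depend on the head position. Its cardinality is thus
  a measure that grows by at most one per step and equals the length of a string on its
  tape.\<close>

definition marked :: "tape \<Rightarrow> int set" where
  "marked t = {i. t i \<noteq> None}"

lemma marked_tape_of: "marked (tape_of x) = int ` {..<length x}"
proof (intro equalityI subsetI)
  fix i assume "i \<in> marked (tape_of x)"
  then have "0 \<le> i" "nat i < length x" by (auto simp: marked_def tape_of_def split: if_splits)
  then show "i \<in> int ` {..<length x}" by (intro image_eqI[of _ _ "nat i"]) auto
qed (auto simp: marked_def tape_of_def)

text \<open>The write affects cell 0 only, and the move translates all coordinates.\<close>

lemma card_marked_act:
  assumes "finite (marked t)"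
  shows "finite (marked (act t a)) \<and> card (marked (act t a)) \<le> Suc (card (marked t))"
proof -
  define t' where "t' = t(0 := fst a)"
  have sub: "marked t' \<subseteq> insert 0 (marked t)" by (auto simp: marked_def t'_def split: if_splits)
  then have fin: "finite (marked t')" using assms finite_subset by blast
  have "card (marked t') \<le> card (insert 0 (marked t))"
    using sub assms by (intro card_mono) auto
  also have "\<dots> \<le> Suc (card (marked t))" by (simp add: card_insert_if assms)
  finally have le: "card (marked t') \<le> Suc (card (marked t))" .
  have "\<exists>c. marked (move (snd a) t') = (\<lambda>i. i + c) ` marked t'"
  proof (cases "snd a")
    case Left
    then show ?thesis
      by (intro exI[of _ 1]) (force simp: marked_def image_iff intro: exI[of _ "_ - 1"])
  next
    case Stay
    then show ?thesis by (intro exI[of _ 0]) simp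
  next
    case Right
    then show ?thesis
      by (intro exI[of _ "-1"]) (force simp: marked_def image_iff intro: exI[of _ "_ + 1"])
  qed
  then obtain c where c: "marked (act t a) = (\<lambda>i. i + c) ` marked t'"
    by (auto simp: act_def t'_def)
  then show ?thesis using fin le card_image_le[OF fin, of "\<lambda>i. i + c"] by simp
qed

lemma card_marked_reaches:
  assumes "tm_wf M" "length ts = ntapes M" "finite (marked (hd ts))"
    "reaches M n (q, ts) (q', ts')"
  shows "card (marked (hd ts')) \<le> card (marked (hd ts)) + n"
  using assms(2-4)
proof (induction n arbitrary: q ts)
  case (Suc n)
  obtain q1 ts1 where 1: "tm_step M (q, ts) = (q1, ts1)" by force
  have len: "length ts1 = ntapes M" using length_tm_step[OF assms(1) Suc.prems(1), of q] 1 by simp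
  have q: "q < nstates M" using Suc.prems by simp
  define as where "as = snd (delta M q (map (\<lambda>t. t 0) ts))"
  have las: "length as = ntapes M" "ntapes M \<noteq> 0"
    using assms(1) q Suc.prems(1) by (auto simp: tm_wf_def as_def)
  have "ts1 = map2 act ts as" using 1 q by (simp add: tm_step_running as_def)
  moreover obtain t ts0 a as0 where "ts = t # ts0" "as = a # as0"
    using las Suc.prems(1) by (cases ts; cases as) auto
  ultimately have hd1: "hd ts1 = act (hd ts) (hd as)" by simp
  have "finite (marked (hd ts1))" "card (marked (hd ts1)) \<le> Suc (card (marked (hd ts)))"
    using card_marked_act[OF Suc.prems(2), of "hd as"] by (auto simp: hd1)
  moreover have "card (marked (hd ts')) \<le> card (marked (hd ts1)) + n"
    using Suc.IH[OF len, of q1] Suc.prems 1 \<open>finite (marked (hd ts1))\<close> by simp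
  ultimately show ?case by simp
qed simp

lemma length_tm_init: "tm_wf M \<Longrightarrow> length (snd (tm_init M x)) = ntapes M"
  by (auto simp: tm_init_def tm_wf_def)

lemma output_length:
  assumes "tm_wf M" "runs M (snd (tm_init M x)) t ts" "hd ts = tape_of y"
  shows "length y \<le> length x + t"
proof -
  from assms(2) obtain n q where n: "n \<le> t" "reaches M n (0, snd (tm_init M x)) (q, ts)"
    by (auto simp: runs_def)
  have "card (marked (hd ts)) \<le> card (marked (hd (snd (tm_init M x)))) + n"
    by (rule card_marked_reaches[OF assms(1) length_tm_init[OF assms(1)] _ n(2)])
      (simp add: tm_init_def marked_tape_of)
  then show ?thesis
    using n(1) by (simp add: assms(3) tm_init_def marked_tape_of card_image)
qed

lemma poly_nat_mono: "m \<le> n \<Longrightarrow> poly p m \<le> poly p (n :: nat)"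
  by (induction p) (auto intro!: mult_mono)

text \<open>The second machine works on the first tape and on fresh tapes, so that the first machine need
  not clean up its work tapes.\<close>

lemma polytime_on_comp:
  assumes "polytime_on S f" "polytime_on T g" "f ` S \<subseteq> T"
  shows "polytime_on S (\<lambda>x. g (f x))"
proof -
  obtain M p where M: "tm_wf M" "\<And>x. x \<in> S \<Longrightarrow>
      \<exists>ts. runs M (snd (tm_init M x)) (poly p (length x)) ts \<and> hd ts = tape_of (f x)"
    using assms(1) by (auto simp: polytime_on_iff_runs)
  obtain N q where N: "tm_wf N" "\<And>x. x \<in> T \<Longrightarrow>
      \<exists>ts. runs N (snd (tm_init N x)) (poly q (length x)) ts \<and> hd ts = tape_of (g x)"
    using assms(2) by (auto simp: polytime_on_iff_runs)
  define m n where "m = ntapes M" and "n = ntapes N"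
  have mn: "1 \<le> m" "1 \<le> n" using M N by (auto simp: m_def n_def tm_wf_def)
  define k where "k = m + n - 1"
  define e where "e j = (if j = 0 then 0 else m + j - 1)" for j
  have e: "inj_on e {..<n}" "e ` {..<n} \<subseteq> {..<k}"
    using mn by (auto simp: inj_on_def e_def k_def split: if_splits)
  define C where "C = lift_tm (\<lambda>j. j) k M ;; lift_tm e k N"
  have wf: "tm_wf C" using mn by (auto simp: C_def k_def)
  \<comment> \<open>The second summand is the running time of \<open>N\<close> at the bound
    \<open>p + [:0, 1:]\<close> on the length of its input \<open>f x\<close>.\<close>
  have "\<exists>ts. runs C (snd (tm_init C x)) (poly (p + q \<circ>\<^sub>p (p + [:0, 1:])) (length x)) ts \<and>
          hd ts = tape_of (g (f x))" if x: "x \<in> S" for x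
  proof -
    from M(2)[OF x] obtain ts where
      ts: "runs M (snd (tm_init M x)) (poly p (length x)) ts" "hd ts = tape_of (f x)" by auto
    have "f x \<in> T" using assms(3) x by auto
    from N(2)[OF this] obtain ts2 where
      ts2: "runs N (snd (tm_init N (f x))) (poly q (length (f x))) ts2"
        "hd ts2 = tape_of (g (f x))" by auto
    have len: "length ts = m" "length ts2 = n"
      using runs_length[OF M(1) length_tm_init[OF M(1)] ts(1)]
        runs_length[OF N(1) length_tm_init[OF N(1)] ts2(1)] by (auto simp: m_def n_def)
    define us where "us = replicate k blank_tape"
    define vs where "vs = put_tapes (\<lambda>j. j) us ts"
    have lus: "length us = k" "length vs = k" by (auto simp: us_def vs_def)
    have init: "snd (tm_init C x) = put_tapes (\<lambda>j. j) us (snd (tm_init M x))"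
    proof (rule nth_equalityI)
      show "length (snd (tm_init C x)) = length (put_tapes (\<lambda>j. j) us (snd (tm_init M x)))"
        using mn by (simp add: lus tm_init_def C_def k_def)
      fix j assume "j < length (snd (tm_init C x))"
      then have j: "j < k" using mn by (simp add: tm_init_def C_def k_def)
      show "snd (tm_init C x) ! j = put_tapes (\<lambda>j. j) us (snd (tm_init M x)) ! j"
      proof (cases "j < m")
        case True
        have "put_tapes (\<lambda>j. j) us (snd (tm_init M x)) ! j = snd (tm_init M x) ! j"
          using True j length_tm_init[OF M(1), of x]
          by (intro put_tapes_nth[where e = "\<lambda>j. j"]) (auto simp: lus m_def)
        then show ?thesis using True j
          by (cases j) (auto simp: tm_init_def C_def m_def)
      next
        case False
        have "put_tapes (\<lambda>j. j) us (snd (tm_init M x)) ! j = us ! j"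
          using False j length_tm_init[OF M(1), of x]
          by (intro put_tapes_other) (auto simp: lus m_def)
        then show ?thesis using False j mn
          by (cases j) (auto simp: tm_init_def C_def us_def)
      qed
    qed
    \<comment> \<open>The tapes left by \<open>M\<close> already contain the initial tapes of
      \<open>N\<close>: tape 0 holds \<open>f x\<close>, and the fresh ones are still blank.\<close>
    have mid: "vs = put_tapes e vs (snd (tm_init N (f x)))"
    proof (rule nth_equalityI)
      fix j assume "j < length vs"
      then have j: "j < k" by (simp add: lus)
      show "vs ! j = put_tapes e vs (snd (tm_init N (f x))) ! j"
      proof (cases "j \<in> e ` {..<n}")
        case True
        then obtain i where i: "i < n" "j = e i" by auto
        have "put_tapes e vs (snd (tm_init N (f x))) ! j = snd (tm_init N (f x)) ! i"
          unfolding i(2) using i j e(1) length_tm_init[OF N(1), of "f x"]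
          by (intro put_tapes_nth) (auto simp: lus n_def)
        moreover have "vs ! j = snd (tm_init N (f x)) ! i"
        proof (cases "i = 0")
          case True
          then have "j = 0" using i by (simp add: e_def)
          have "vs ! 0 = ts ! 0"
            unfolding vs_def using mn len k_def
            by (intro put_tapes_nth[where e = "\<lambda>j. j"]) (auto simp: lus)
          then show ?thesis using True \<open>j = 0\<close> ts(2) len mn
            by (cases ts) (auto simp: tm_init_def)
        next
          case False
          then have "j \<ge> m" using i by (simp add: e_def)
          have "vs ! j = us ! j"
            unfolding vs_def using \<open>j \<ge> m\<close> j len by (intro put_tapes_other) (auto simp: lus)
          then show ?thesis using False i j
            by (cases i) (auto simp: tm_init_def us_def n_def)
        qed
        ultimately show ?thesis by simp
      next
        case False
        then show ?thesis
          using j length_tm_init[OF N(1), of "f x"] by (simp add: put_tapes_other lus n_def)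
      qed
    qed (simp add: lus)
    have "runs (lift_tm (\<lambda>j. j) k M) (snd (tm_init C x)) (poly p (length x)) vs"
      unfolding init vs_def lus(1)[symmetric]
      by (rule runs_lift[OF M(1) length_tm_init[OF M(1)] _ _ ts(1)])
        (use mn in \<open>auto simp: lus k_def m_def\<close>)
    moreover have "runs (lift_tm e k N) vs (poly q (length (f x))) (put_tapes e vs ts2)"
    proof -
      have "runs (lift_tm e (length vs) N) (put_tapes e vs (snd (tm_init N (f x))))
          (poly q (length (f x))) (put_tapes e vs ts2)"
        by (rule runs_lift[OF N(1) length_tm_init[OF N(1)] _ _ ts2(1)])
          (use e in \<open>auto simp: lus n_def\<close>)
      then show ?thesis by (simp add: lus flip: mid)
    qed
    ultimately have "runs C (snd (tm_init C x)) (poly p (length x) + poly q (length (f x)))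
        (put_tapes e vs ts2)"
      unfolding C_def by (rule runs_seq)
    moreover have "length (f x) \<le> poly p (length x) + length x"
      using output_length[OF M(1) ts] by simp
    then have "poly p (length x) + poly q (length (f x)) \<le>
        poly (p + q \<circ>\<^sub>p (p + [:0, 1:])) (length x)"
      by (simp add: poly_pcompose poly_nat_mono)
    moreover have "hd (put_tapes e vs ts2) = tape_of (g (f x))"
    proof -
      have "put_tapes e vs ts2 ! e 0 = ts2 ! 0"
        using mn e by (intro put_tapes_nth) (auto simp: len lus e_def k_def)
      moreover have "put_tapes e vs ts2 \<noteq> []" "ts2 \<noteq> []"
        using mn len lus k_def by (auto simp flip: length_0_conv)
      ultimately show ?thesis using ts2(2) by (simp add: hd_conv_nth e_def)
    qed
    ultimately show ?thesis using runs_mono by blast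
  qed
  then show ?thesis using wf unfolding polytime_on_iff_runs by blast
qed

subsection \<open>Stack machines\<close>

text \<open>A tape whose head scans the first bit of its contents acts as a stack: popping erases that bit
  and moves right, pushing moves left and writes.\<close>

definition top :: "bool list \<Rightarrow> bool option" where
  "top xs = (case xs of [] \<Rightarrow> None | b # _ \<Rightarrow> Some b)"

lemma top_simps [simp]: "top [] = None" "top (b # xs) = Some b"
  by (auto simp: top_def)

definition skip_tm :: "nat \<Rightarrow> tm" where
  "skip_tm k = \<lparr>ntapes = k, nstates = 0, delta = (\<lambda>q rs. (0, []))\<rparr>"

definition push_tm :: "nat \<Rightarrow> nat \<Rightarrow> bool \<Rightarrow> tm" where
  "push_tm k i b = \<lparr>ntapes = k, nstates = 2,
     delta = (\<lambda>q rs. if q = 0 then (1, (keep rs)[i := (rs ! i, Left)])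
                     else (2, (keep rs)[i := (Some b, Stay)]))\<rparr>"

definition pop_tm :: "nat \<Rightarrow> nat \<Rightarrow> tm" where
  "pop_tm k i = \<lparr>ntapes = k, nstates = 1, delta = (\<lambda>q rs. (1, (keep rs)[i := (None, Right)]))\<rparr>"

lemma ntapes_stack [simp]:
  "ntapes (skip_tm k) = k" "ntapes (push_tm k i b) = k" "ntapes (pop_tm k i) = k"
  by (auto simp: skip_tm_def push_tm_def pop_tm_def)

lemma tm_wf_stack [simp]:
  "1 \<le> k \<Longrightarrow> tm_wf (skip_tm k)" "1 \<le> k \<Longrightarrow> tm_wf (push_tm k i b)" "1 \<le> k \<Longrightarrow> tm_wf (pop_tm k i)"
  by (auto simp: tm_wf_def skip_tm_def push_tm_def pop_tm_def)

lemma tape_of_0 [simp]: "tape_of xs 0 = top xs"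
  by (cases xs) (auto simp: tape_of_def)

lemma act_pop: "act (tape_of xs) (None, Right) = tape_of (tl xs)"
proof
  fix i
  show "act (tape_of xs) (None, Right) i = tape_of (tl xs) i"
    by (auto simp: act_def tape_of_def nth_tl nat_add_distrib)
qed

lemma act_push: "act (act (tape_of xs) (top xs, Left)) (Some b, Stay) = tape_of (b # xs)"
proof
  fix i
  show "act (act (tape_of xs) (top xs, Left)) (Some b, Stay) i = tape_of (b # xs) i"
    by (cases xs) (auto simp: act_def tape_of_def nth_Cons' nat_diff_distrib)
qed

lemma map2_act_update:
  "i < length ts \<Longrightarrow> map2 act ts ((keep (map (\<lambda>t. t 0) ts))[i := a]) = ts[i := act (ts ! i) a]"
  by (rule nth_equalityI) (auto simp: keep_def nth_list_update)

definition stack_runs :: "tm \<Rightarrow> bool list list \<Rightarrow> nat \<Rightarrow> bool list list \<Rightarrow> bool" where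
  "stack_runs M st t st' \<longleftrightarrow> runs M (map tape_of st) t (map tape_of st')"

lemma stack_runs_mono: "stack_runs M st t st' \<Longrightarrow> t \<le> t' \<Longrightarrow> stack_runs M st t' st'"
  unfolding stack_runs_def by (rule runs_mono)

lemma stack_runs_skip: "stack_runs (skip_tm k) st 0 st"
  by (auto simp: stack_runs_def runs_def skip_tm_def)

lemma stack_runs_push:
  assumes "i < length st"
  shows "stack_runs (push_tm k i b) st 2 (st[i := b # st ! i])"
proof -
  let ?ts = "map tape_of st"
  have "tm_step (push_tm k i b) (0, ?ts) = (1, ?ts[i := act (?ts ! i) (top (st ! i), Left)])"
    using assms map2_act_update[of i ?ts "(top (st ! i), Left)"]
    by (simp add: tm_step_def push_tm_def)
  moreover have "tm_step (push_tm k i b) (1, ?ts[i := act (?ts ! i) (top (st ! i), Left)]) =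
      (2, ?ts[i := tape_of (b # st ! i)])"
    using assms map2_act_update[of i "?ts[i := act (?ts ! i) (top (st ! i), Left)]" "(Some b, Stay)"]
    by (simp add: tm_step_def push_tm_def act_push)
  ultimately have "reaches (push_tm k i b) 2 (0, ?ts) (2, ?ts[i := tape_of (b # st ! i)])"
    by (simp add: numeral_2_eq_2) (simp add: push_tm_def)
  then show ?thesis
    by (auto simp: stack_runs_def runs_def map_update push_tm_def intro!: exI[of _ 2])
qed

lemma stack_runs_pop:
  assumes "i < length st"
  shows "stack_runs (pop_tm k i) st 1 (st[i := tl (st ! i)])"
proof -
  let ?ts = "map tape_of st"
  have "tm_step (pop_tm k i) (0, ?ts) = (1, ?ts[i := tape_of (tl (st ! i))])"
    using assms map2_act_update[of i ?ts "(None, Right)"]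
    by (simp add: tm_step_def pop_tm_def act_pop)
  then have "reaches (pop_tm k i) 1 (0, ?ts) (1, ?ts[i := tape_of (tl (st ! i))])"
    by simp (simp add: pop_tm_def)
  then show ?thesis
    by (auto simp: stack_runs_def runs_def map_update pop_tm_def intro!: exI[of _ 1])
qed

lemma stack_runs_seq:
  "stack_runs M st a st' \<Longrightarrow> stack_runs N st' b st'' \<Longrightarrow> stack_runs (M ;; N) st (a + b) st''"
  unfolding stack_runs_def by (rule runs_seq)

lemma stack_runs_if:
  assumes "i < length st" "P (top (st ! i)) \<Longrightarrow> stack_runs M st t st'"
    "\<not> P (top (st ! i)) \<Longrightarrow> stack_runs N st t st'"
  shows "stack_runs (if_tm i P M N) st (Suc t) st'"
  using assms unfolding stack_runs_def
  by (cases "P (top (st ! i))") (auto intro: runs_if_True runs_if_False)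

lemma stack_runs_while_False:
  "i < length st \<Longrightarrow> \<not> P (top (st ! i)) \<Longrightarrow> stack_runs (while_tm i P M) st 1 st"
  unfolding stack_runs_def by (rule runs_while_False) auto

lemma stack_runs_while_True:
  assumes "i < length st" "P (top (st ! i))" "stack_runs M st a st'"
    "stack_runs (while_tm i P M) st' b st''"
  shows "stack_runs (while_tm i P M) st (Suc (a + b)) st''"
  using assms unfolding stack_runs_def by (intro runs_while_True) auto

text \<open>Blank work tapes are empty stacks, and only the first tape counts at the end, so the
  others may keep any contents.\<close>

lemma polytime_on_stackI:
  assumes "tm_wf M" "ntapes M = Suc k"
    and "\<And>x. x \<in> S \<Longrightarrow> \<exists>st. stack_runs M (x # replicate k []) (poly p (length x)) (f x # st)"
  shows "polytime_on S f"
  unfolding polytime_on_iff_runs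
proof (intro exI[of _ M] exI[of _ p] conjI ballI)
  fix x assume "x \<in> S"
  from assms(3)[OF this] obtain st where
    "stack_runs M (x # replicate k []) (poly p (length x)) (f x # st)" ..
  moreover have "snd (tm_init M x) = map tape_of (x # replicate k [])"
    using assms(2) by (auto simp: tm_init_def tape_of_def blank_tape_def)
  ultimately show "\<exists>ts. runs M (snd (tm_init M x)) (poly p (length x)) ts \<and> hd ts = tape_of (f x)"
    by (intro exI[of _ "map tape_of (f x # st)"]) (simp add: stack_runs_def)
qed (fact assms)

text \<open>An empty source stack supplies \<open>False\<close>.\<close>

definition shift_tm :: "nat \<Rightarrow> nat \<Rightarrow> nat \<Rightarrow> tm" where
  "shift_tm k i j = if_tm i (\<lambda>c. c = Some True) (push_tm k j True) (push_tm k j False) ;; pop_tm k i"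

definition transfer_tm :: "nat \<Rightarrow> nat \<Rightarrow> nat \<Rightarrow> tm" where
  "transfer_tm k i j = while_tm i (\<lambda>c. c \<noteq> None) (shift_tm k i j)"

definition clear_tm :: "nat \<Rightarrow> nat \<Rightarrow> tm" where
  "clear_tm k i = while_tm i (\<lambda>c. c \<noteq> None) (pop_tm k i)"

lemma ntapes_stack2 [simp]:
  "ntapes (shift_tm k i j) = k" "ntapes (transfer_tm k i j) = k" "ntapes (clear_tm k i) = k"
  by (auto simp: shift_tm_def transfer_tm_def clear_tm_def)

lemma tm_wf_stack2 [simp]:
  "1 \<le> k \<Longrightarrow> tm_wf (shift_tm k i j)" "1 \<le> k \<Longrightarrow> tm_wf (transfer_tm k i j)"
  "1 \<le> k \<Longrightarrow> tm_wf (clear_tm k i)"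
  by (auto simp: shift_tm_def transfer_tm_def clear_tm_def)

lemma stack_runs_shift:
  assumes "i < length st" "j < length st" "i \<noteq> j"
  shows "stack_runs (shift_tm k i j) st 4
           (st[j := (top (st ! i) = Some True) # st ! j, i := tl (st ! i)])"
proof -
  let ?st = "st[j := (top (st ! i) = Some True) # st ! j]"
  have "stack_runs (if_tm i (\<lambda>c. c = Some True) (push_tm k j True) (push_tm k j False)) st (Suc 2) ?st"
    using assms stack_runs_push[of j st k True] stack_runs_push[of j st k False]
    by (intro stack_runs_if) auto
  from stack_runs_seq[OF this stack_runs_pop[of i ?st k]] show ?thesis
    using assms by (simp add: shift_tm_def numeral_eq_Suc)
qed

lemma stack_runs_transfer:
  assumes "i < length st" "j < length st" "i \<noteq> j"
  shows "stack_runs (transfer_tm k i j) st (5 * length (st ! i) + 1)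
           (st[i := [], j := rev (st ! i) @ st ! j])"
  using assms
proof (induction "st ! i" arbitrary: st)
  case Nil
  then have "st[i := [], j := rev (st ! i) @ st ! j] = st"
    by (metis append_Nil list_update_id rev.simps(1))
  then show ?case
    using Nil stack_runs_while_False[of i st "\<lambda>c. c \<noteq> None"] by (simp add: transfer_tm_def)
next
  case (Cons b xs)
  let ?st = "st[j := (top (st ! i) = Some True) # st ! j, i := tl (st ! i)]"
  have xs: "?st ! i = xs" using Cons by (simp flip: Cons(2))
  have "stack_runs (transfer_tm k i j) ?st (5 * length xs + 1)
      (?st[i := [], j := rev xs @ ?st ! j])"
    using Cons.hyps(1)[of ?st] Cons.prems xs by simp
  then have "stack_runs (transfer_tm k i j) st (Suc (4 + (5 * length xs + 1)))
      (?st[i := [], j := rev xs @ ?st ! j])"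
    unfolding transfer_tm_def using Cons.prems stack_runs_shift[OF Cons.prems, of k]
    by (intro stack_runs_while_True[where st' = ?st]) (auto simp flip: Cons(2))
  moreover have "?st[i := [], j := rev xs @ ?st ! j] = st[i := [], j := rev (st ! i) @ st ! j]"
    using Cons.prems by (simp add: list_update_swap flip: Cons(2))
  ultimately show ?case by (simp add: algebra_simps flip: Cons(2))
qed

lemma stack_runs_clear:
  assumes "i < length st"
  shows "stack_runs (clear_tm k i) st (2 * length (st ! i) + 1) (st[i := []])"
  using assms
proof (induction "st ! i" arbitrary: st)
  case Nil
  then have "st[i := []] = st" by (metis list_update_id)
  then show ?case
    using Nil stack_runs_while_False[of i st "\<lambda>c. c \<noteq> None"] by (simp add: clear_tm_def)
next
  case (Cons b xs)
  let ?st = "st[i := tl (st ! i)]"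
  have xs: "?st ! i = xs" using Cons by (simp flip: Cons(2))
  have "stack_runs (clear_tm k i) ?st (2 * length xs + 1) (?st[i := []])"
    using Cons.hyps(1)[of ?st] Cons.prems xs by simp
  then have "stack_runs (clear_tm k i) st (Suc (1 + (2 * length xs + 1))) (?st[i := []])"
    unfolding clear_tm_def using Cons.prems stack_runs_pop[OF Cons.prems, of k]
    by (intro stack_runs_while_True[where st' = ?st]) (auto simp flip: Cons(2))
  then show ?case by (simp add: algebra_simps flip: Cons(2))
qed

subsection \<open>Polynomial-time string functions\<close>

lemma list_update_Cons_simps [simp]:
  "(x # xs)[1 := y] = x # xs[0 := y]"
  "(x # xs)[numeral n := y] = x # xs[pred_numeral n := y]"
  by (auto simp: numeral_eq_Suc)

text \<open>Composing the rules yields some final stacks and some time; both are compared with the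
  intended ones only at the end.\<close>

lemma stack_runs_conv:
  "stack_runs M st t st' \<Longrightarrow> st' = st'' \<Longrightarrow> t \<le> t' \<Longrightarrow> stack_runs M st t' st''"
  using stack_runs_mono by blast

lemmas stack_runs_basic =
  stack_runs_seq stack_runs_push stack_runs_pop stack_runs_shift stack_runs_transfer stack_runs_clear

text \<open>One block of \<open>enc_list\<close> without its closing bit; machines treat the two
  separately.\<close>

definition pairs :: "bool list \<Rightarrow> bool list" where
  "pairs x = concat (map (\<lambda>b. [True, b]) x)"

lemma pairs_simps [simp]:
  "pairs [] = []" "pairs (b # x) = True # b # pairs x" "pairs (x @ y) = pairs x @ pairs y"
  "length (pairs x) = 2 * length x"
  by (induction x) (auto simp: pairs_def)

lemma enc_list_simps [simp]:
  "enc_list [] = []" "enc_list (x # xs) = pairs x @ False # enc_list xs"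
  by (auto simp: enc_list_def pairs_def)

text \<open>The marker bits say whether a block continues, so both blocks end at the same place.
  This makes decoding unambiguous.\<close>

lemma pairs_delimited_eq [simp]: "pairs x @ False # r = pairs y @ False # s \<longleftrightarrow> x = y \<and> r = s"
proof (induction x arbitrary: y)
  case Nil
  then show ?case by (cases y) auto
next
  case (Cons b x)
  then show ?case by (cases y) auto
qed

text \<open>On a string that breaks off after a marker, the missing bit counts as
  \<open>False\<close>, exactly as \<open>shift_tm\<close> treats an empty source. Hence the machine
  is correct on all strings, as membership of a verifier in \<open>class_P\<close> demands.\<close>

fun first_string :: "bool list \<Rightarrow> bool list" where
  "first_string (True # z) = (top z = Some True) # first_string (tl z)"
| "first_string z = []"

lemma first_string_pairs [simp]: "first_string (pairs x @ False # z) = x"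
  by (induction x) auto

text \<open>The string is collected in reverse on stack 1. The rest \<open>r\<close> of the input is
  then erased, and the transfer back restores the order.\<close>

lemma polytime_first_string: "polytime_on UNIV first_string"
proof -
  define W where "W = while_tm 0 (\<lambda>c. c = Some True) (pop_tm 2 0 ;; shift_tm 2 0 1)"
  have loop: "\<exists>r. length r \<le> length z \<and> length (first_string z) \<le> length z \<and>
      stack_runs W [z, a] (6 * length z + 1) [r, rev (first_string z) @ a]" for z a
  proof (induction z arbitrary: a rule: first_string.induct)
    case (1 z)
    let ?a = "(top z = Some True) # a"
    obtain r where r: "length r \<le> length (tl z)" "length (first_string (tl z)) \<le> length (tl z)"
      "stack_runs W [tl z, ?a] (6 * length (tl z) + 1) [r, rev (first_string (tl z)) @ ?a]"
      using 1 by blast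
    have "stack_runs (pop_tm 2 0 ;; shift_tm 2 0 1) [True # z, a] 5 [tl z, ?a]"
      by (rule stack_runs_conv, (rule stack_runs_basic | (auto; fail))+)
    from stack_runs_while_True[OF _ _ this r(3)[unfolded W_def]]
    have "stack_runs W [True # z, a] (Suc (5 + (6 * length (tl z) + 1)))
        [r, rev (first_string (tl z)) @ ?a]"
      by (simp add: W_def)
    then have "stack_runs W [True # z, a] (6 * length (True # z) + 1)
        [r, rev (first_string (True # z)) @ a]"
      by (rule stack_runs_conv) auto
    then show ?case using r(1,2) by (intro exI[of _ r]) auto
  qed (auto simp: W_def intro!: exI stack_runs_while_False[THEN stack_runs_mono])
  show ?thesis
  proof (rule polytime_on_stackI[where k = 1 and p = "[:3, 13:]" and
        M = "W ;; clear_tm 2 0 ;; transfer_tm 2 1 0"])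
    fix x :: "bool list"
    obtain r where r: "length r \<le> length x" "length (first_string x) \<le> length x"
      "stack_runs W [x, []] (6 * length x + 1) [r, rev (first_string x)]"
      using loop[of x "[]"] by auto
    have "stack_runs (W ;; clear_tm 2 0 ;; transfer_tm 2 1 0) [x, []] (3 + 13 * length x)
        [first_string x, []]"
      by (rule stack_runs_conv, rule stack_runs_seq[OF r(3)], (rule stack_runs_basic | (auto; fail))+)
        (use r in auto)
    then show "\<exists>st. stack_runs (W ;; clear_tm 2 0 ;; transfer_tm 2 1 0) (x # replicate 1 [])
        (poly [:3, 13:] (length x)) (first_string x # st)"
      by (auto simp: algebra_simps)
  qed (auto simp: W_def)
qed

text \<open>The constant is built into the machine, one push per bit and the last bit first. It
  later supplies the fixed part of codes.\<close>

lemma polytime_append: "polytime_on UNIV (\<lambda>x. c @ x)"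
proof -
  define W where "W = rec_list (skip_tm 1) (\<lambda>b _ M. M ;; push_tm 1 0 b)"
  have wf: "tm_wf (W c) \<and> ntapes (W c) = 1" for c by (induction c) (auto simp: W_def)
  have runs: "stack_runs (W c) [x] (2 * length c) [c @ x]" for c x
  proof (induction c)
    case Nil
    then show ?case using stack_runs_skip by (simp add: W_def)
  next
    case (Cons b c)
    have "stack_runs (W c ;; push_tm 1 0 b) [x] (2 * length (b # c)) [(b # c) @ x]"
      by (rule stack_runs_conv, rule stack_runs_seq[OF Cons], rule stack_runs_push) auto
    then show ?case by (simp add: W_def)
  qed
  show ?thesis
    by (rule polytime_on_stackI[where k = 0 and p = "[:2 * length c:]" and M = "W c"])
      (use wf runs in auto)
qed

text \<open>The block grows from its end: the closing bit comes first, then each bit followed by the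
  marker in front of it.\<close>

lemma polytime_enc: "polytime_on UNIV (\<lambda>x. enc_list [x])"
proof -
  define W where "W = while_tm 1 (\<lambda>c. c \<noteq> None) (shift_tm 2 1 0 ;; push_tm 2 0 True)"
  have loop: "stack_runs W [a, xs] (7 * length xs + 1) [pairs (rev xs) @ a, []]" for a xs
  proof (induction xs arbitrary: a)
    case Nil
    show ?case unfolding W_def by (rule stack_runs_conv, rule stack_runs_while_False) auto
  next
    case (Cons b xs)
    have "stack_runs (shift_tm 2 1 0 ;; push_tm 2 0 True) [a, b # xs] 6 [True # b # a, xs]"
      by (rule stack_runs_conv, (rule stack_runs_basic | (auto; fail))+)
    from stack_runs_while_True[OF _ _ this Cons[unfolded W_def]]
    show ?case unfolding W_def by (rule stack_runs_conv) auto
  qed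
  let ?M = "transfer_tm 2 0 1 ;; push_tm 2 0 False ;; W"
  show ?thesis
  proof (rule polytime_on_stackI[where k = 1 and p = "[:4, 12:]" and M = ?M])
    fix x :: "bool list"
    have 1: "stack_runs (transfer_tm 2 0 1) [x, []] (5 * length x + 1) [[], rev x]"
      by (rule stack_runs_conv, rule stack_runs_transfer) auto
    have 2: "stack_runs (push_tm 2 0 False) [[], rev x] 2 [[False], rev x]"
      by (rule stack_runs_conv, rule stack_runs_push) auto
    have "stack_runs ?M [x, []] (4 + 12 * length x) [enc_list [x], []]"
      by (rule stack_runs_conv, rule stack_runs_seq[OF 1 stack_runs_seq[OF 2 loop]]) auto
    then show "\<exists>st. stack_runs ?M (x # replicate 1 []) (poly [:4, 12:] (length x)) (enc_list [x] # st)"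
      by (auto simp: algebra_simps)
  qed (auto simp: W_def)
qed

text \<open>A numeral is positive iff it contains the bit 1, so this is the sign test for
  numerators.\<close>

lemma polytime_contains_True: "polytime_on UNIV (\<lambda>y. [True \<in> set y])"
proof -
  define W where "W = while_tm 0 (\<lambda>c. c = Some False) (pop_tm 1 0)"
  have loop: "stack_runs W [y] (2 * length y + 1) [dropWhile Not y]" for y
  proof (induction y)
    case Nil
    show ?case unfolding W_def by (rule stack_runs_conv, rule stack_runs_while_False) auto
  next
    case (Cons b y)
    show ?case
    proof (cases b)
      case True
      then show ?thesis unfolding W_def
        by (intro stack_runs_conv[OF stack_runs_while_False]) auto
    next
      case False
      have "stack_runs (pop_tm 1 0) [b # y] 1 [y]"
        by (rule stack_runs_conv, rule stack_runs_pop) auto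
      from stack_runs_while_True[OF _ _ this Cons[unfolded W_def]]
      show ?thesis unfolding W_def by (rule stack_runs_conv) (use False in auto)
    qed
  qed
  let ?N = "if_tm 0 (\<lambda>c. c = Some True) (clear_tm 1 0 ;; push_tm 1 0 True) (push_tm 1 0 False)"
  have decide: "stack_runs ?N [d] (Suc (2 * length d + 3)) [[b]]"
    if "d = [] \<and> \<not> b \<or> (\<exists>z. d = True # z) \<and> b" for d b
    using that
  proof
    assume d: "d = [] \<and> \<not> b"
    have "stack_runs (push_tm 1 0 False) [d] (2 * length d + 3) [[b]]"
      by (rule stack_runs_conv, rule stack_runs_push) (use d in auto)
    then show ?thesis using d by (intro stack_runs_if) auto
  next
    assume d: "(\<exists>z. d = True # z) \<and> b"
    have "stack_runs (clear_tm 1 0 ;; push_tm 1 0 True) [d] (2 * length d + 3) [[b]]"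
      by (rule stack_runs_conv, (rule stack_runs_basic | (auto; fail))+) (use d in auto)
    then show ?thesis using d by (intro stack_runs_if) auto
  qed
  show ?thesis
  proof (rule polytime_on_stackI[where k = 0 and p = "[:5, 4:]" and M = "W ;; ?N"])
    fix y :: "bool list"
    let ?y = "dropWhile Not y"
    have len: "length ?y \<le> length y" by (rule length_dropWhile_le)
    have "?y = [] \<and> True \<notin> set y \<or> (\<exists>z. ?y = True # z) \<and> True \<in> set y"
      by (induction y) auto
    note decide[OF this]
    from stack_runs_seq[OF loop this]
    have "stack_runs (W ;; ?N) [y] (5 + 4 * length y) [[True \<in> set y]]"
      by (rule stack_runs_conv) (use len in auto)
    then show "\<exists>st. stack_runs (W ;; ?N) (y # replicate 0 []) (poly [:5, 4:] (length y))
        ([True \<in> set y] # st)"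
      by (auto simp: algebra_simps)
  qed (auto simp: W_def)
qed


subsection \<open>Padding\<close>

abbreviation zeros :: "nat \<Rightarrow> bool list" where
  "zeros n \<equiv> replicate n False"

text \<open>Stack \<open>i\<close> is a unary counter whose symbols are ignored; each unit becomes
  the marked bit \<open>True, False\<close>, one zero of a coded block on stack 0.\<close>

definition emit_tm :: "nat \<Rightarrow> nat \<Rightarrow> tm" where
  "emit_tm k i = while_tm i (\<lambda>c. c \<noteq> None) (pop_tm k i ;; push_tm k 0 False ;; push_tm k 0 True)"

text \<open>Two copies of the counter are made, because squaring takes two factors and the zeros
  later enter both numerator and denominator.\<close>

definition unpad_tm :: "nat \<Rightarrow> tm" where
  "unpad_tm k = while_tm 0 (\<lambda>c. c = Some True)
     (pop_tm k 0 ;; pop_tm k 0 ;; push_tm k 1 True ;; push_tm k 2 True)"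

lemma emit_unpad_simps [simp]:
  "ntapes (emit_tm k i) = k" "ntapes (unpad_tm k) = k"
  "1 \<le> k \<Longrightarrow> tm_wf (emit_tm k i)" "1 \<le> k \<Longrightarrow> tm_wf (unpad_tm k)"
  by (auto simp: emit_tm_def unpad_tm_def)

lemma pairs_zeros_shift: "pairs (zeros n) @ True # False # a = True # False # pairs (zeros n) @ a"
  by (induction n) auto

lemma pairs_zeros_add: "pairs (zeros (m + n)) = pairs (zeros n) @ pairs (zeros m)"
  by (subst add.commute) (simp add: replicate_add)

lemma replicate_shift: "replicate n b @ b # a = b # replicate n b @ a"
  by (induction n) auto

lemma stack_runs_emit:
  assumes "i < length st" "0 < i"
  shows "stack_runs (emit_tm k i) st (6 * length (st ! i) + 1)
           (st[i := [], 0 := pairs (zeros (length (st ! i))) @ st ! 0])"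
  using assms
proof (induction "st ! i" arbitrary: st)
  case Nil
  then have "st[i := []] = st" by (metis list_update_id)
  then show ?case using Nil stack_runs_while_False[of i st "\<lambda>c. c \<noteq> None"]
    by (simp add: emit_tm_def flip: Nil(1))
next
  case (Cons b xs)
  let ?st = "st[i := xs, 0 := True # False # st ! 0]"
  have "0 < length st" using Cons.prems by linarith
  then have "stack_runs (pop_tm k i ;; push_tm k 0 False ;; push_tm k 0 True) st 5 ?st"
    by - (rule stack_runs_conv,
        (rule stack_runs_basic | (use Cons.prems Cons(2)[symmetric] in auto; fail))+)
  moreover have "stack_runs (emit_tm k i) ?st (6 * length xs + 1)
      (?st[i := [], 0 := pairs (zeros (length xs)) @ ?st ! 0])"
    using Cons.hyps(1)[of ?st] Cons.prems by simp
  ultimately have "stack_runs (emit_tm k i) st (Suc (5 + (6 * length xs + 1)))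
      (?st[i := [], 0 := pairs (zeros (length xs)) @ ?st ! 0])"
    unfolding emit_tm_def using Cons.prems
    by (intro stack_runs_while_True[where st' = ?st]) (auto simp flip: Cons(2))
  moreover have "?st[i := [], 0 := pairs (zeros (length xs)) @ ?st ! 0] =
      st[i := [], 0 := pairs (zeros (length (st ! i))) @ st ! 0]"
    using Cons.prems \<open>0 < length st\<close>
    by (simp add: list_update_swap pairs_zeros_shift flip: Cons(2))
  ultimately show ?case by (simp add: algebra_simps flip: Cons(2))
qed

lemma stack_runs_unpad:
  "stack_runs (unpad_tm k) ((pairs (zeros m) @ False # r) # a # b # st) (7 * m + 1)
     ((False # r) # (replicate m True @ a) # (replicate m True @ b) # st)"
proof (induction m arbitrary: a b)
  case 0
  show ?case unfolding unpad_tm_def by (rule stack_runs_conv, rule stack_runs_while_False) auto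
next
  case (Suc m)
  have "stack_runs (pop_tm k 0 ;; pop_tm k 0 ;; push_tm k 1 True ;; push_tm k 2 True)
      ((pairs (zeros (Suc m)) @ False # r) # a # b # st) 6
      ((pairs (zeros m) @ False # r) # (True # a) # (True # b) # st)"
    by (rule stack_runs_conv, (rule stack_runs_basic | (auto; fail))+)
  from stack_runs_while_True[OF _ _ this Suc[unfolded unpad_tm_def]]
  show ?case unfolding unpad_tm_def by (rule stack_runs_conv) (auto simp: replicate_shift)
qed

lemma polytime_pad_length: "polytime_on UNIV (\<lambda>x. enc_list [zeros (length x)] @ x)"
proof -
  define W where "W = while_tm 0 (\<lambda>c. c \<noteq> None) (shift_tm 3 0 1 ;; push_tm 3 2 True)"
  have loop: "stack_runs W [xs, a, b] (7 * length xs + 1)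
      [[], rev xs @ a, replicate (length xs) True @ b]" for xs a b
  proof (induction xs arbitrary: a b)
    case Nil
    show ?case unfolding W_def by (rule stack_runs_conv, rule stack_runs_while_False) auto
  next
    case (Cons x xs)
    have "stack_runs (shift_tm 3 0 1 ;; push_tm 3 2 True) [x # xs, a, b] 6 [xs, x # a, True # b]"
      by (rule stack_runs_conv, (rule stack_runs_basic | (auto; fail))+)
    from stack_runs_while_True[OF _ _ this Cons[unfolded W_def]]
    show ?case unfolding W_def by (rule stack_runs_conv) (auto simp: replicate_shift)
  qed
  let ?N = "transfer_tm 3 1 0 ;; push_tm 3 0 False ;; emit_tm 3 2"
  show ?thesis
  proof (rule polytime_on_stackI[where k = 2 and p = "[:5, 18:]" and M = "W ;; ?N"])
    fix x :: "bool list"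
    have "stack_runs ?N [[], rev x, replicate (length x) True] (4 + 11 * length x)
        [enc_list [zeros (length x)] @ x, [], []]"
      by (rule stack_runs_conv, (rule stack_runs_basic stack_runs_emit | (auto; fail))+)
    from stack_runs_seq[OF loop[of x "[]" "[]", simplified] this]
    have "stack_runs (W ;; ?N) [x, [], []] (5 + 18 * length x)
        [enc_list [zeros (length x)] @ x, [], []]"
      by (rule stack_runs_conv) auto
    then show "\<exists>st. stack_runs (W ;; ?N) (x # replicate 2 []) (poly [:5, 18:] (length x))
        ((enc_list [zeros (length x)] @ x) # st)"
      by (auto simp: algebra_simps numeral_2_eq_2)
  qed (auto simp: W_def)
qed

text \<open>Multiplication of two unary counters by repeated addition. \<open>r\<close> is never
  inspected, and the closing bit of the old block serves the new one.\<close>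

lemma polytime_square_padding:
  "\<exists>f. polytime_on {enc_list [zeros m] @ r | m r. True} f \<and>
     (\<forall>m r. f (enc_list [zeros m] @ r) = enc_list [zeros (m\<^sup>2)] @ r)"
proof -
  \<comment> \<open>A pass of \<open>V\<close> emits as many zeros as stack 2 holds while saving
    that counter on stack 3; \<open>W\<close> restores it before the next round.\<close>
  define V where "V = while_tm 2 (\<lambda>c. c \<noteq> None)
    (shift_tm 4 2 3 ;; push_tm 4 0 False ;; push_tm 4 0 True)"
  define W where "W = while_tm 1 (\<lambda>c. c \<noteq> None) (pop_tm 4 1 ;; V ;; transfer_tm 4 3 2)"
  have inner: "stack_runs V [r, a, xs, d] (9 * length xs + 1)
      [pairs (zeros (length xs)) @ r, a, [], rev xs @ d]" for r a xs d
  proof (induction xs arbitrary: r d)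
    case Nil
    show ?case unfolding V_def by (rule stack_runs_conv, rule stack_runs_while_False) auto
  next
    case (Cons x xs)
    have "stack_runs (shift_tm 4 2 3 ;; push_tm 4 0 False ;; push_tm 4 0 True) [r, a, x # xs, d] 8
        [True # False # r, a, xs, x # d]"
      by (rule stack_runs_conv, (rule stack_runs_basic | (auto; fail))+)
    from stack_runs_while_True[OF _ _ this Cons[unfolded V_def]]
    show ?case unfolding V_def by (rule stack_runs_conv) (auto simp: pairs_zeros_shift)
  qed
  have outer: "stack_runs W [r, a, xs, []] (length a * (14 * length xs + 4) + 1)
      [pairs (zeros (length a * length xs)) @ r, [], xs, []]" for r a xs
  proof (induction a arbitrary: r)
    case Nil
    show ?case unfolding W_def by (rule stack_runs_conv, rule stack_runs_while_False) auto
  next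
    case (Cons b a)
    have 1: "stack_runs (pop_tm 4 1) [r, b # a, xs, []] 1 [r, a, xs, []]"
      by (rule stack_runs_conv, (rule stack_runs_basic | (auto; fail))+)
    have 2: "stack_runs (transfer_tm 4 3 2) [pairs (zeros (length xs)) @ r, a, [], rev xs]
       (5 * length xs + 1) [pairs (zeros (length xs)) @ r, a, xs, []]"
      by (rule stack_runs_conv, (rule stack_runs_basic | (auto; fail))+)
    have "stack_runs (pop_tm 4 1 ;; V ;; transfer_tm 4 3 2) [r, b # a, xs, []]
        (1 + (9 * length xs + 1 + (5 * length xs + 1))) [pairs (zeros (length xs)) @ r, a, xs, []]"
      using 1 2 inner[of r a xs "[]"] by (intro stack_runs_seq) auto
    from stack_runs_while_True[OF _ _ this Cons[unfolded W_def]]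
    show ?case unfolding W_def
      by (rule stack_runs_conv) (auto simp: algebra_simps pairs_zeros_add)
  qed
  \<comment> \<open>The function is fixed by its values on codes alone; choice suffices since the
    decomposition is unique, and values elsewhere lie outside the promise.\<close>
  define f where "f z = (SOME y. \<exists>m r. z = enc_list [zeros m] @ r \<and> y = enc_list [zeros (m\<^sup>2)] @ r)"
    for z
  have f: "f (enc_list [zeros m] @ r) = enc_list [zeros (m\<^sup>2)] @ r" for m r
    unfolding f_def by (rule some_equality) auto
  let ?M = "unpad_tm 4 ;; W"
  have "polytime_on {enc_list [zeros m] @ r | m r. True} f"
  proof (rule polytime_on_stackI[where k = 3 and p = "[:2, 11, 14:]" and M = ?M])
    fix x assume "x \<in> {enc_list [zeros m] @ r | m r. True}"
    then obtain m r where x: "x = enc_list [zeros m] @ r" by auto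
    have "stack_runs ?M [x, [], [], []] (7 * m + 1 + (m * (14 * m + 4) + 1))
        [f x, [], replicate m True, []]"
      unfolding x f
      using stack_runs_seq[OF stack_runs_unpad[of 4 m r "[]" "[]" "[[]]", simplified]
        outer[of "False # r" "replicate m True" "replicate m True", simplified]]
      by (simp add: power2_eq_square)
    moreover have "7 * m + 1 + (m * (14 * m + 4) + 1) \<le> poly [:2, 11, 14:] m"
      by (simp add: algebra_simps)
    moreover have "poly [:2, 11, 14:] m \<le> poly [:2, 11, 14:] (length x)"
      by (rule poly_nat_mono) (simp add: x)
    ultimately have "stack_runs ?M [x, [], [], []] (poly [:2, 11, 14:] (length x))
        [f x, [], replicate m True, []]"
      using stack_runs_mono order_trans by blast
    then show "\<exists>st. stack_runs ?M (x # replicate 3 []) (poly [:2, 11, 14:] (length x)) (f x # st)"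
      by (auto simp: numeral_3_eq_3 simp del: poly_pCons)
  qed (auto simp: W_def V_def)
  then show ?thesis using f by blast
qed

text \<open>The new zeros go in front of \<open>u\<close> and \<open>v\<close>, below which more
  data lie on the stack; hence the coded \<open>w\<close> and \<open>u\<close> are set aside in
  reverse until \<open>v\<close> has been treated.\<close>

lemma polytime_insert_padding:
  "\<exists>f. polytime_on {enc_list [zeros n, w, u, v] | n w u v. True} f \<and>
     (\<forall>n w u v. f (enc_list [zeros n, w, u, v]) =
        enc_list [w, False # zeros n @ u, True # zeros n @ v])"
proof -
  define W where "W i = while_tm 0 (\<lambda>c. c = Some True) (shift_tm 5 0 i ;; shift_tm 5 0 i)" for i
  have copy3: "stack_runs (W 3) [pairs x @ False # r, a, b, c, d] (9 * length x + 1)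
      [False # r, a, b, rev (pairs x) @ c, d]" for x r a b c d
  proof (induction x arbitrary: c)
    case Nil
    show ?case unfolding W_def by (rule stack_runs_conv, rule stack_runs_while_False) auto
  next
    case (Cons y x)
    have "stack_runs (shift_tm 5 0 3 ;; shift_tm 5 0 3)
        [pairs (y # x) @ False # r, a, b, c, d] 8 [pairs x @ False # r, a, b, y # True # c, d]"
      by (rule stack_runs_conv, (rule stack_runs_basic | (auto; fail))+)
    from stack_runs_while_True[OF _ _ this Cons[unfolded W_def]]
    show ?case unfolding W_def by (rule stack_runs_conv) auto
  qed
  have copy4: "stack_runs (W 4) [pairs x @ False # r, a, b, c, d] (9 * length x + 1)
      [False # r, a, b, c, rev (pairs x) @ d]" for x r a b c d
  proof (induction x arbitrary: d)
    case Nil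
    show ?case unfolding W_def by (rule stack_runs_conv, rule stack_runs_while_False) auto
  next
    case (Cons y x)
    have "stack_runs (shift_tm 5 0 4 ;; shift_tm 5 0 4)
        [pairs (y # x) @ False # r, a, b, c, d] 8 [pairs x @ False # r, a, b, c, y # True # d]"
      by (rule stack_runs_conv, (rule stack_runs_basic | (auto; fail))+)
    from stack_runs_while_True[OF _ _ this Cons[unfolded W_def]]
    show ?case unfolding W_def by (rule stack_runs_conv) auto
  qed
  let ?pop = "pop_tm 5 0"
  \<comment> \<open>After the closing bit of \<open>u\<close> is dropped, the output is written from
    its end, on top of the coded \<open>v\<close>. Two pushes of \<open>True\<close> give the marked
    bit 1, \<open>False\<close> followed by \<open>True\<close> gives the marked bit 0, and the
    remaining two pushes of \<open>False\<close> close the blocks of \<open>u\<close> and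
    \<open>w\<close>.\<close>
  let ?out = "?pop ;; emit_tm 5 1 ;; push_tm 5 0 True ;; push_tm 5 0 True ;; push_tm 5 0 False ;;
    transfer_tm 5 4 0 ;; emit_tm 5 2 ;; push_tm 5 0 False ;; push_tm 5 0 True ;;
    push_tm 5 0 False ;; transfer_tm 5 3 0"
  let ?M = "unpad_tm 5 ;; ?pop ;; W 3 ;; ?pop ;; W 4 ;; ?out"
  define f where "f z = (SOME y. \<exists>n w u v. z = enc_list [zeros n, w, u, v] \<and>
      y = enc_list [w, False # zeros n @ u, True # zeros n @ v])" for z
  have f: "f (enc_list [zeros n, w, u, v]) = enc_list [w, False # zeros n @ u, True # zeros n @ v]"
    for n w u v
    unfolding f_def by (rule some_equality) auto
  have "polytime_on {enc_list [zeros n, w, u, v] | n w u v. True} f"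
  proof (rule polytime_on_stackI[where k = 4 and p = "[:30, 100:]" and M = ?M])
    fix x assume "x \<in> {enc_list [zeros n, w, u, v] | n w u v. True}"
    then obtain n w u v where x: "x = enc_list [zeros n, w, u, v]" by auto
    let ?t = "replicate n True"
    have 1: "stack_runs (unpad_tm 5) [x, [], [], [], []] (7 * n + 1)
        [False # enc_list [w, u, v], ?t, ?t, [], []]"
      using stack_runs_unpad[of 5 n "enc_list [w, u, v]" "[]" "[]" "[[], []]"] by (simp add: x)
    have 2: "stack_runs ?pop [False # r, a, b, c, d] 1 [r, a, b, c, d]" for r a b c d
      by (rule stack_runs_conv, rule stack_runs_pop) auto
    have 3: "stack_runs (W 3) [enc_list [w, u, v], ?t, ?t, [], []] (9 * length w + 1)
        [False # enc_list [u, v], ?t, ?t, rev (pairs w), []]"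
      using copy3[of w "enc_list [u, v]" ?t ?t "[]" "[]"] by simp
    have 4: "stack_runs (W 4) [enc_list [u, v], ?t, ?t, rev (pairs w), []] (9 * length u + 1)
        [False # enc_list [v], ?t, ?t, rev (pairs w), rev (pairs u)]"
      using copy4[of u "enc_list [v]" ?t ?t "rev (pairs w)" "[]"] by simp
    have 5: "stack_runs ?out [False # enc_list [v], ?t, ?t, rev (pairs w), rev (pairs u)]
        (17 + 12 * n + 10 * length u + 10 * length w) [f x, [], [], [], []]"
      unfolding x f
      by (rule stack_runs_conv, (rule stack_runs_basic stack_runs_emit | (auto; fail))+)
    have "stack_runs ?M [x, [], [], [], []] (30 + 100 * length x) [f x, [], [], [], []]"
      by (rule stack_runs_conv,
          rule stack_runs_seq[OF 1 stack_runs_seq[OF 2 stack_runs_seq[OF 3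
            stack_runs_seq[OF 2 stack_runs_seq[OF 4 5]]]]])
        (auto simp: x)
    then show "\<exists>st. stack_runs ?M (x # replicate 4 []) (poly [:30, 100:] (length x)) (f x # st)"
      by (auto simp: algebra_simps numeral_eq_Suc)
  qed (auto simp: W_def)
  then show ?thesis using f by blast
qed

text \<open>Each squaring doubles the exponent, so a fixed number \<open>k\<close> of compositions
  reaches \<open>2 ^ k\<close>.\<close>

lemma polytime_pad_power:
  "polytime_on UNIV (\<lambda>x. enc_list [zeros ((length x + 2) ^ (2 ^ k))] @ x)"
proof (induction k)
  case 0
  \<comment> \<open>The prefix consists of two marked zeros. They make the base of the power at
    least 2, where it dominates polynomials.\<close>
  have "polytime_on UNIV (\<lambda>x. [True, False, True, False] @ enc_list [zeros (length x)] @ x)"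
    by (rule polytime_on_comp[OF polytime_pad_length polytime_append]) simp
  then show ?case by simp
next
  case (Suc k)
  obtain f where f: "polytime_on {enc_list [zeros m] @ r | m r. True} f"
    "\<And>m r. f (enc_list [zeros m] @ r) = enc_list [zeros (m\<^sup>2)] @ r"
    using polytime_square_padding by blast
  have "polytime_on UNIV (\<lambda>x. f (enc_list [zeros ((length x + 2) ^ (2 ^ k))] @ x))"
    by (rule polytime_on_comp[OF Suc f(1)]) blast
  then show ?case
    by (rule polytime_on_cong) (simp only: f(2) power_Suc2 power_mult)
qed

text \<open>The number of zeros is computed from the whole code, so that it can dominate both a
  polynomial in the length of \<open>w\<close> and the length of \<open>u\<close>.\<close>

lemma polytime_refine_fraction:
  "\<exists>f. polytime_on {enc_list [w, u, v] | w u v. True} f \<and>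
     (\<forall>w u v. \<exists>n. n = (length (enc_list [w, u, v]) + 2) ^ (2 ^ k) \<and>
        f (enc_list [w, u, v]) = enc_list [w, False # zeros n @ u, True # zeros n @ v])"
proof -
  obtain f where f: "polytime_on {enc_list [zeros n, w, u, v] | n w u v. True} f"
    "\<And>n w u v. f (enc_list [zeros n, w, u, v]) =
       enc_list [w, False # zeros n @ u, True # zeros n @ v]"
    using polytime_insert_padding by blast
  let ?g = "\<lambda>x. enc_list [zeros ((length x + 2) ^ (2 ^ k))] @ x"
  have g: "?g (enc_list [w, u, v]) =
      enc_list [zeros ((length (enc_list [w, u, v]) + 2) ^ (2 ^ k)), w, u, v]" for w u v
    by simp
  have "polytime_on {enc_list [w, u, v] | w u v. True} (\<lambda>x. f (?g x))"
  proof (rule polytime_on_comp[OF polytime_on_subset[OF polytime_pad_power] f(1)])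
    show "?g ` {enc_list [w, u, v] | w u v. True} \<subseteq> {enc_list [zeros n, w, u, v] | n w u v. True}"
      using g by blast
  qed simp
  moreover have "f (?g (enc_list [w, u, v])) = enc_list [w, False # zeros n @ u, True # zeros n @ v]"
    if "n = (length (enc_list [w, u, v]) + 2) ^ (2 ^ k)" for n w u v
    unfolding g f(2) that ..
  ultimately show ?thesis by (intro exI[of _ "\<lambda>x. f (?g x)"]) blast
qed

section \<open>Polynomial bounds by iterated squares\<close>

lemma poly_le_power: "\<exists>k. \<forall>m\<ge>2. poly p m \<le> (m :: nat) ^ k"
proof (induction p)
  case 0
  then show ?case by simp
next
  case (pCons a p)
  then obtain k where k: "\<And>m. m \<ge> 2 \<Longrightarrow> poly p m \<le> m ^ k" by blast
  \<comment> \<open>Both summands of the Horner form are at most \<open>m ^ (a + k + 1)\<close>, the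
    constant because \<open>a < 2 ^ a\<close>; the last factor \<open>m \<ge> 2\<close> absorbs
    their sum.\<close>
  have "poly (pCons a p) m \<le> m ^ (a + k + 2)" if m: "m \<ge> 2" for m
  proof -
    have "a < 2 ^ a" by simp
    also have "(2 :: nat) ^ a \<le> m ^ a" using m by (intro power_mono) auto
    also have "\<dots> \<le> m ^ (a + k + 1)" using m by (intro power_increasing) auto
    finally have 1: "a \<le> m ^ (a + k + 1)" by simp
    have "m * poly p m \<le> m * m ^ k" using k[OF m] by simp
    also have "\<dots> = m ^ (k + 1)" by simp
    also have "\<dots> \<le> m ^ (a + k + 1)" using m by (intro power_increasing) auto
    finally have "m * poly p m \<le> m ^ (a + k + 1)" .
    with 1 have "poly (pCons a p) m \<le> 2 * m ^ (a + k + 1)" unfolding poly_pCons by linarith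
    also have "\<dots> \<le> m * m ^ (a + k + 1)" using m by (intro mult_right_mono) auto
    finally show ?thesis by simp
  qed
  then show ?case by blast
qed

lemma poly_le_power_power: "\<exists>k. \<forall>m\<ge>2. poly p m \<le> (m :: nat) ^ (2 ^ k)"
proof -
  obtain k where k: "\<And>m. m \<ge> 2 \<Longrightarrow> poly p m \<le> m ^ k" using poly_le_power by blast
  have "poly p m \<le> m ^ (2 ^ k)" if "m \<ge> 2" for m :: nat
    by (rule order_trans[OF k[OF that] power_increasing]) (use that in \<open>auto intro: less_imp_le\<close>)
  then show ?thesis by blast
qed


subsection \<open>Thresholds\<close>

lemma nat_of_bits_simps [simp]:
  "nat_of_bits [] = 0" "nat_of_bits (b # bs) = of_bool b + 2 * nat_of_bits bs"
  by (auto simp: nat_of_bits_def)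

lemma nat_of_bits_zeros_append [simp]: "nat_of_bits (zeros n @ u) = 2 ^ n * nat_of_bits u"
  by (induction n) auto

lemma nat_of_bits_less: "nat_of_bits u < 2 ^ length u"
  by (induction u) auto

lemma nat_of_bits_pos_iff: "0 < nat_of_bits u \<longleftrightarrow> True \<in> set u"
  by (induction u) auto

text \<open>\<open>u' / v' = u M / (v M + 1)\<close> with \<open>M\<close> a large power of two lies so close below \<open>u / v\<close> that no
  fraction with the given denominator fits in between.\<close>

lemma strict_threshold:
  assumes "is_frac u v" "is_frac a b" "0 < frac_val a b" "length b + length u \<le> Suc n"
  shows "is_frac (False # zeros n @ u) (True # zeros n @ v)"
    and "frac_val (False # zeros n @ u) (True # zeros n @ v) < frac_val a b \<longleftrightarrow>
      frac_val u v \<le> frac_val a b"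
proof -
  define U V A B M where "U = nat_of_bits u" and "V = nat_of_bits v" and "A = nat_of_bits a" and
    "B = nat_of_bits b" and "M = (2 :: nat) ^ Suc n"
  note defs = U_def V_def A_def B_def M_def
  show "is_frac (False # zeros n @ u) (True # zeros n @ v)"
    by (simp add: is_frac_def)
  have pos: "0 < V" "0 < B" "0 < A"
    using assms(1-3) by (auto simp: is_frac_def frac_val_def defs intro!: Nat.gr0I)
  have "frac_val (False # zeros n @ u) (True # zeros n @ v) < frac_val a b \<longleftrightarrow>
      real (U * M) / real (V * M + 1) < real A / real B"
    by (simp add: frac_val_def defs algebra_simps)
  also have "\<dots> \<longleftrightarrow> real (U * M * B) < real (A * (V * M + 1))"
  proof -
    have "0 < real (V * M + 1)" "0 < real B" unfolding of_nat_0_less_iff using pos by simp_all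
    then show ?thesis
      by (simp only: pos_divide_less_eq pos_less_divide_eq times_divide_eq_left of_nat_mult)
  qed
  also have "\<dots> \<longleftrightarrow> U * M * B < A * (V * M + 1)" by (rule of_nat_less_iff)
  \<comment> \<open>A false integer inequality fails by at least 1, hence by at least
    \<open>M\<close> after scaling, and \<open>M \<ge> A\<close> outweighs the term \<open>A\<close>
    stemming from the 1 in \<open>V * M + 1\<close>. Conversely, \<open>A > 0\<close> makes the
    scaled comparison strict.\<close>
  also have "\<dots> \<longleftrightarrow> U * B \<le> A * V"
  proof
    assume "U * B \<le> A * V"
    then have "U * B * M \<le> A * V * M" by (rule mult_right_mono) simp
    then have "U * B * M < A * V * M + A" using pos by linarith
    then show "U * M * B < A * (V * M + 1)" by (simp add: algebra_simps)
  next
    assume less: "U * M * B < A * (V * M + 1)"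
    show "U * B \<le> A * V"
    proof (rule ccontr)
      assume not: "\<not> U * B \<le> A * V"
      then have "(A * V + 1) * M \<le> U * B * M" by (intro mult_right_mono) auto
      then have "A * V * M + M \<le> U * B * M" by (simp only: distrib_right mult_1)
      \<comment> \<open>\<open>A\<close> is controlled through the failed comparison,
        \<open>A \<le> A * V \<le> U * B\<close>, and thus by the lengths of \<open>u\<close> and
        \<open>b\<close>.\<close>
      moreover have "A \<le> M"
      proof -
        have "A * 1 \<le> A * V" using pos by (intro mult_left_mono) auto
        also have "\<dots> \<le> U * B" using not by simp
        also have "\<dots> \<le> 2 ^ length u * 2 ^ length b"
          unfolding defs by (intro mult_mono nat_of_bits_less[THEN less_imp_le]) auto
        also have "\<dots> \<le> M"
          unfolding defs power_add[symmetric] using assms(4) by (intro power_increasing) auto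
        finally show ?thesis by simp
      qed
      ultimately have "A * V * M + A \<le> U * B * M" by linarith
      then show False using less by (simp add: algebra_simps)
    qed
  qed
  also have "\<dots> \<longleftrightarrow> real (U * B) \<le> real (A * V)" by (rule of_nat_le_iff[symmetric])
  also have "\<dots> \<longleftrightarrow> frac_val u v \<le> frac_val a b"
  proof -
    have "frac_val u v = real U / real V" "frac_val a b = real A / real B"
      by (simp_all add: frac_val_def defs)
    moreover have "0 < real V" "0 < real B" using pos by simp_all
    ultimately show ?thesis
      by (simp only: pos_divide_le_eq pos_le_divide_eq times_divide_eq_left of_nat_mult)
  qed
  finally show "frac_val (False # zeros n @ u) (True # zeros n @ v) < frac_val a b \<longleftrightarrow>
      frac_val u v \<le> frac_val a b" .
qed

section \<open>From hardness of the optimum to inapproximability\<close>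

lemma class_P_subset_class_NP: "class_P \<subseteq> class_NP"
proof
  fix A assume "A \<in> class_P"
  then have "polytime_on UNIV (\<lambda>x. [x \<in> A])" by (simp add: class_P_def)
  from polytime_on_comp[OF polytime_first_string this]
  have "{z. first_string z \<in> A} \<in> class_P" by (simp add: class_P_def)
  \<comment> \<open>The verifier ignores the certificate, and the length bound 0 admits only the
    empty one.\<close>
  then show "A \<in> class_NP"
    unfolding class_NP_def by (intro CollectI bexI[of _ "{z. first_string z \<in> A}"] exI[of _ 0]) auto
qed

lemma finite_small_scenarios: "finite (ground I) \<Longrightarrow> finite (small_scenarios I)"
  by (simp add: small_scenarios_def)

lemma empty_small_scenario: "{} \<in> small_scenarios I"
  by (simp add: small_scenarios_def)

lemma opt_Pi_attained:
  assumes "finite (ground I)"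
  obtains A where "A \<in> small_scenarios I" "recourse I zero_decision A = opt_Pi I"
proof -
  have "opt_Pi I \<in> recourse I zero_decision ` small_scenarios I"
    unfolding opt_Pi_def
    by (rule Max_in) (use assms finite_small_scenarios empty_small_scenario in auto)
  then show thesis using that by auto
qed

lemma recourse_le_opt_Pi:
  "finite (ground I) \<Longrightarrow> A \<in> small_scenarios I \<Longrightarrow> recourse I zero_decision A \<le> opt_Pi I"
  unfolding opt_Pi_def by (intro Max_ge) (auto simp: finite_small_scenarios)

text \<open>The constant prefix \<open>c\<close> lets one argument serve two problems: it is empty
  for the penalized value and codes the central distribution for the expectation.\<close>

lemma not_approximable_if_positive_iff_below_opt:
  assumes fin: "\<And>w. w \<in> D \<Longrightarrow> finite (ground (inst w))"
    and sizes: "poly_size_values D inst"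
    and hard: "NP_hard (Pi_yes D inst) (Pi_no D inst)"
    and opt: "\<And>w. w \<in> D \<Longrightarrow> 1 \<le> opt_Pi (inst w)"
    and "class_P \<noteq> class_NP"
    and Q: "insts Q = {(w, u, v). w \<in> D \<and> is_frac u v}"
      "\<And>w u v. code Q (w, u, v) = c @ enc_list [w, u, v]"
    and val_nonneg: "\<And>w u v. w \<in> D \<Longrightarrow> is_frac u v \<Longrightarrow> 0 \<le> val Q (w, u, v)"
    and val_pos: "\<And>w u v. w \<in> D \<Longrightarrow> is_frac u v \<Longrightarrow>
      0 < val Q (w, u, v) \<longleftrightarrow> frac_val u v < opt_Pi (inst w)"
  shows "\<not> approximable Q"
proof
  assume "approximable Q"
  then obtain F \<alpha> where F: "polytime_on (code Q ` insts Q) F"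
    and approx: "\<And>i. i \<in> insts Q \<Longrightarrow> 1 \<le> (\<alpha> i :: real) \<and>
        (\<exists>u v. F (code Q i) = enc_list [u, v] \<and> is_frac u v \<and>
           val Q i / \<alpha> i \<le> frac_val u v \<and> frac_val u v \<le> \<alpha> i * val Q i)"
    unfolding approximable_def by blast
  have F_pos: "True \<in> set (first_string (F (c @ enc_list [w, u, v]))) \<longleftrightarrow>
      frac_val u v < opt_Pi (inst w)" if wuv: "w \<in> D" "is_frac u v" for w u v
  proof -
    let ?i = "(w, u, v)"
    obtain u' v' where 1: "1 \<le> \<alpha> ?i" "F (code Q ?i) = enc_list [u', v']" "is_frac u' v'"
      "val Q ?i / \<alpha> ?i \<le> frac_val u' v'" "frac_val u' v' \<le> \<alpha> ?i * val Q ?i"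
      using approx[of ?i] wuv by (auto simp: Q)
    \<comment> \<open>The first string of an answer is its numerator, and the denominator is
      positive, so the bits of the numerator decide the sign.\<close>
    have "True \<in> set (first_string (F (c @ enc_list [w, u, v]))) \<longleftrightarrow> 0 < frac_val u' v'"
      using 1(2,3) by (simp add: Q nat_of_bits_pos_iff[symmetric] is_frac_def frac_val_def
          zero_less_divide_iff)
    also have "\<dots> \<longleftrightarrow> 0 < val Q ?i"
    proof
      assume "0 < frac_val u' v'"
      then have "val Q ?i \<noteq> 0" using 1(5) by auto
      then show "0 < val Q ?i" using val_nonneg[OF wuv] by simp
    next
      assume "0 < val Q ?i"
      then have "0 < val Q ?i / \<alpha> ?i" using 1(1) by simp
      then show "0 < frac_val u' v'" using 1(4) by linarith
    qed
    finally show ?thesis using val_pos[OF wuv] by simp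
  qed
  obtain q where q: "\<And>w A. w \<in> D \<Longrightarrow> A \<in> small_scenarios (inst w) \<Longrightarrow>
      \<exists>u v. is_frac u v \<and> recourse (inst w) zero_decision A = frac_val u v \<and>
           length u + length v \<le> poly q (length w)"
    using sizes unfolding poly_size_values_def by blast
  \<comment> \<open>\<open>q\<close> accounts for the denominator of the optimum, the identity
    \<open>[:0, 1:]\<close> for the numerator \<open>u\<close> of the threshold, whose length is
    bounded only by that of the whole code.\<close>
  obtain k where k: "\<And>m. m \<ge> 2 \<Longrightarrow> poly (q + [:0, 1:]) m \<le> m ^ (2 ^ k)"
    using poly_le_power_power by blast
  obtain g where g: "polytime_on {enc_list [w, u, v] | w u v. True} g"
    "\<And>w u v. \<exists>n. n = (length (enc_list [w, u, v]) + 2) ^ (2 ^ k) \<and>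
        g (enc_list [w, u, v]) = enc_list [w, False # zeros n @ u, True # zeros n @ v]"
    using polytime_refine_fraction[of k] by blast
  have g_correct: "\<exists>u' v'. g (enc_list [w, u, v]) = enc_list [w, u', v'] \<and> is_frac u' v' \<and>
      (frac_val u' v' < opt_Pi (inst w) \<longleftrightarrow> frac_val u v \<le> opt_Pi (inst w))"
    if wuv: "w \<in> D" "is_frac u v" for w u v
  proof -
    define L where "L = length (enc_list [w, u, v]) + 2"
    obtain n where n: "n = L ^ (2 ^ k)"
      "g (enc_list [w, u, v]) = enc_list [w, False # zeros n @ u, True # zeros n @ v]"
      using g(2)[of w u v] unfolding L_def by blast
    obtain A where A: "A \<in> small_scenarios (inst w)"
      "recourse (inst w) zero_decision A = opt_Pi (inst w)"
      using opt_Pi_attained[OF fin[OF wuv(1)]] .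
    obtain a b where ab: "is_frac a b" "opt_Pi (inst w) = frac_val a b"
      "length a + length b \<le> poly q (length w)"
      using q[OF wuv(1) A(1)] A(2) by auto
    have "length b + length u \<le> poly q (length w) + L" using ab(3) by (simp add: L_def)
    also have "poly q (length w) \<le> poly q L" by (rule poly_nat_mono) (simp add: L_def)
    also have "poly q L + L \<le> n" using k[of L] by (simp add: n(1)) (simp add: L_def)
    finally have len: "length b + length u \<le> Suc n" by simp
    have "0 < frac_val a b" using opt[OF wuv(1)] by (simp add: ab(2))
    note threshold = strict_threshold[OF wuv(2) ab(1) this len]
    show ?thesis
      unfolding ab(2) by (rule exI, rule exI, rule conjI[OF n(2) conjI[OF threshold]])
  qed
  have "A \<in> class_P" if A: "A \<in> class_NP" for A
  proof -
    obtain f where f: "polytime_on UNIV f"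
      "\<And>x. x \<in> A \<Longrightarrow> f x \<in> Pi_yes D inst" "\<And>x. x \<notin> A \<Longrightarrow> f x \<in> Pi_no D inst"
      using bspec[OF hard[unfolded NP_hard_def] A] by (elim exE conjE) (simp add: all_conj_distrib)
    have f_form: "\<exists>w u v. f x = enc_list [w, u, v] \<and> w \<in> D \<and> is_frac u v \<and>
        (x \<in> A \<longleftrightarrow> frac_val u v \<le> opt_Pi (inst w))" for x
      using f(2,3)[of x] unfolding Pi_yes_def Pi_no_def by (cases "x \<in> A") blast+
    have gf_form: "\<exists>w u v. g (f x) = enc_list [w, u, v] \<and> w \<in> D \<and> is_frac u v \<and>
        (x \<in> A \<longleftrightarrow> frac_val u v < opt_Pi (inst w))" for x
      using f_form[of x] g_correct by metis
    have "polytime_on UNIV (\<lambda>x. g (f x))"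
      by (rule polytime_on_comp[OF f(1) g(1)]) (use f_form in blast)
    then have "polytime_on UNIV (\<lambda>x. c @ g (f x))"
      by (rule polytime_on_comp[OF _ polytime_append]) simp
    then have "polytime_on UNIV (\<lambda>x. F (c @ g (f x)))"
    proof (rule polytime_on_comp[OF _ F])
      \<comment> \<open>\<open>F\<close> is trusted only on codes of instances, and every refined
        query is one.\<close>
      show "range (\<lambda>x. c @ g (f x)) \<subseteq> code Q ` insts Q"
      proof
        fix z assume "z \<in> range (\<lambda>x. c @ g (f x))"
        then obtain x where x: "z = c @ g (f x)" by auto
        obtain w u v where "g (f x) = enc_list [w, u, v]" "w \<in> D" "is_frac u v"
          using gf_form by blast
        then show "z \<in> code Q ` insts Q"
          using x by (intro image_eqI[of _ _ "(w, u, v)"]) (simp_all add: Q)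
      qed
    qed
    then have "polytime_on UNIV (\<lambda>x. first_string (F (c @ g (f x))))"
      by (rule polytime_on_comp[OF _ polytime_first_string]) simp
    then have "polytime_on UNIV (\<lambda>x. [True \<in> set (first_string (F (c @ g (f x))))])"
      by (rule polytime_on_comp[OF _ polytime_contains_True]) simp
    moreover have "True \<in> set (first_string (F (c @ g (f x)))) \<longleftrightarrow> x \<in> A" for x
      using gf_form[of x] F_pos by metis
    ultimately show ?thesis by (simp add: class_P_def)
  qed
  then have "class_P = class_NP" using class_P_subset_class_NP by blast
  then show False using \<open>class_P \<noteq> class_NP\<close> by contradiction
qed


subsection \<open>The point mass at the empty scenario\<close>

text \<open>Not depending on the instance, it has constant size and contributes a fixed prefix to
  codes; expectations and sums over its support collapse to one term.\<close>

definition point_mass :: dist_list where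
  "point_mass = [([], [True], [True])]"

lemma frac_val_one [simp]: "frac_val [True] [True] = 1"
  by (simp add: frac_val_def)

lemma dist_table_point_mass: "dist_table point_mass = [({}, 1)]"
  by (simp add: dist_table_def point_mass_def)

lemma central_dist_point_mass [simp]: "central_dist point_mass = return_pmf {}"
proof (rule pmf_eqI)
  fix A :: "nat set"
  have "pmf_of_list_wf [({} :: nat set, 1 :: real)]" by (simp add: pmf_of_list_wf_def)
  then show "pmf (central_dist point_mass) A = pmf (return_pmf {}) A"
    by (auto simp: central_dist_def dist_table_point_mass pmf_pmf_of_list)
qed

lemma valid_central_point_mass: "valid_central D inst (\<lambda>_. point_mass)"
proof -
  have "\<exists>q :: nat poly. \<forall>w\<in>D. length (enc_dist point_mass) \<le> poly q (length w)"
    by (rule exI[of _ "[:length (enc_dist point_mass):]"]) simp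
  then show ?thesis
    unfolding valid_central_def
    by (auto simp: dist_table_point_mass pmf_of_list_wf_def empty_small_scenario)
      (auto simp: point_mass_def is_frac_def)
qed

section \<open>One instance, in either setting\<close>

locale robust_instance =
  fixes s :: setting and I :: two_stage and Z :: real
  assumes finite_ground: "finite (ground I)"
    and recourse_nonneg: "\<And>A. A \<subseteq> ground I \<Longrightarrow> 0 \<le> recourse I zero_decision A"
    and recourse_le_Z: "\<And>A. s = B2 \<Longrightarrow> A \<subseteq> ground I \<Longrightarrow> recourse I zero_decision A \<le> Z / 2"
    and recourse_empty: "recourse I zero_decision {} = 0"
    and opt_ge_1: "1 \<le> opt_Pi I"
begin

lemma finite_scenarios: "finite (scenarios s I)"
  using finite_ground finite_small_scenarios by (cases s) auto

lemma small_subset_scenarios: "small_scenarios I \<subseteq> scenarios s I"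
  by (cases s) (auto simp: small_scenarios_def)

text \<open>The empty scenario has value 0 and the optimum is at least 1, so a maximizer is
  nonempty; being small, it lies at distance 1 from \<open>{}\<close> in both settings.\<close>

lemma optimal_scenario:
  obtains A where "A \<in> scenarios s I" "recourse I zero_decision A = opt_Pi I"
    "sc_metric s I Z {} A = 1"
proof -
  obtain A where A: "A \<in> small_scenarios I" "recourse I zero_decision A = opt_Pi I"
    using opt_Pi_attained[OF finite_ground] .
  have "A \<noteq> {}" using A opt_ge_1 recourse_empty by auto
  then have "sc_metric s I Z {} A = 1" using A by (cases s) (auto simp: small_scenarios_def)
  then show thesis using that A small_subset_scenarios by blast
qed

text \<open>Seen from \<open>{}\<close>, the two settings differ only in the third case, which
  requires \<open>B2\<close>; there \<open>0 \<le> Z\<close> because \<open>Z / 2\<close> bounds a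
  nonnegative value.\<close>

lemma scenario_cases:
  assumes "A \<in> scenarios s I"
  obtains (empty) "A = {}" "sc_metric s I Z {} A = 0"
  | (small) "recourse I zero_decision A \<le> opt_Pi I" "sc_metric s I Z {} A = 1"
  | (large) "recourse I zero_decision A \<le> Z / 2" "0 \<le> Z" "sc_metric s I Z {} A = Z"
proof -
  consider "A = {}" | "A \<noteq> {}" "A \<in> small_scenarios I" | "A \<noteq> {}" "A \<notin> small_scenarios I" by blast
  then show thesis
  proof cases
    case 1
    then show thesis using empty by (cases s) auto
  next
    case 2
    then have "sc_metric s I Z {} A = 1" by (cases s) (auto simp: small_scenarios_def)
    then show thesis using small recourse_le_opt_Pi[OF finite_ground 2(2)] by blast
  next
    case 3
    then have s: "s = B2" using assms by (cases s) auto
    then have sub: "A \<subseteq> ground I" using assms by simp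
    have "sc_metric s I Z {} A = Z" using s 3 sub by (auto simp: small_scenarios_def)
    moreover have "0 \<le> Z" using recourse_le_Z[OF s sub] recourse_nonneg[OF sub] by linarith
    ultimately show thesis using large recourse_le_Z[OF s sub] by blast
  qed
qed

lemma empty_scenario: "{} \<in> scenarios s I" "sc_metric s I Z {} {} = 0"
  by (cases s; simp add: small_scenarios_def)+

text \<open>Staying at \<open>{}\<close> costs nothing and yields 0.\<close>

lemma penalized_nonneg: "0 \<le> penalized I (scenarios s I) (sc_metric s I Z) zero_decision y {}"
  unfolding penalized_def
  by (rule Max_ge) (use finite_scenarios empty_scenario recourse_empty in
      \<open>auto intro!: image_eqI[of _ _ "{}"]\<close>)

lemma penalized_pos_iff:
  assumes "0 \<le> y"
  shows "0 < penalized I (scenarios s I) (sc_metric s I Z) zero_decision y {} \<longleftrightarrow> y < opt_Pi I"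
proof -
  have "0 < penalized I (scenarios s I) (sc_metric s I Z) zero_decision y {} \<longleftrightarrow>
      (\<exists>A\<in>scenarios s I. 0 < recourse I zero_decision A - y * sc_metric s I Z {} A)"
    unfolding penalized_def
    by (subst Max_gr_iff) (use finite_scenarios empty_scenario in auto)
  also have "\<dots> \<longleftrightarrow> y < opt_Pi I"
  proof
    assume "\<exists>A\<in>scenarios s I. 0 < recourse I zero_decision A - y * sc_metric s I Z {} A"
    then obtain A where A: "A \<in> scenarios s I"
      "0 < recourse I zero_decision A - y * sc_metric s I Z {} A" by blast
    from A(1) show "y < opt_Pi I"
    proof (cases rule: scenario_cases)
      case empty
      then show ?thesis using A(2) recourse_empty by simp
    next
      case small
      then show ?thesis using A(2) by simp
    next
      case large
      then have "Z * y < Z * (1 / 2)" using A(2) by (simp add: mult.commute)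
      then have "y < 1 / 2" using large(2) by (rule mult_left_less_imp_less)
      then show ?thesis using opt_ge_1 by simp
    qed
  next
    assume "y < opt_Pi I"
    moreover obtain A where "A \<in> scenarios s I" "recourse I zero_decision A = opt_Pi I"
      "sc_metric s I Z {} A = 1" using optimal_scenario .
    ultimately show "\<exists>A\<in>scenarios s I. 0 < recourse I zero_decision A - y * sc_metric s I Z {} A"
      by (intro bexI[of _ A]) auto
  qed
  finally show ?thesis .
qed

text \<open>Linear programming duality: by \<open>g_le\<close>, price \<open>opt_Pi I\<close> for
  transport and price 0 for mass is dual feasible, with value \<open>opt_Pi I\<close> at radius
  1.\<close>

lemma worst_case_point_mass:
  "worst_case I (scenarios s I) (sc_metric s I Z) (return_pmf {}) 1 zero_decision = opt_Pi I"
proof -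
  let ?g = "recourse I zero_decision" and ?\<kappa> = "sc_metric s I Z {}" and ?S = "scenarios s I"
  let ?T = "transport_plans ?S (sc_metric s I Z) (return_pmf {}) 1"
  have g_le: "?g A \<le> opt_Pi I * ?\<kappa> A" if "A \<in> ?S" for A
    using that
  proof (cases rule: scenario_cases)
    case large
    have "Z / 2 \<le> 1 * Z" using large by simp
    also have "\<dots> \<le> opt_Pi I * Z" using large opt_ge_1 by (intro mult_right_mono) auto
    finally show ?thesis using large by simp
  qed (auto simp: recourse_empty)
  have le: "(\<Sum>A\<in>?S. \<gamma> {} A * ?g A) \<le> opt_Pi I" if "\<gamma> \<in> ?T" for \<gamma>
  proof -
    have "(\<Sum>A\<in>?S. \<gamma> {} A * ?g A) \<le> (\<Sum>A\<in>?S. \<gamma> {} A * (opt_Pi I * ?\<kappa> A))"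
      using that g_le by (intro sum_mono mult_left_mono) (auto simp: transport_plans_def)
    also have "\<dots> = opt_Pi I * (\<Sum>A\<in>?S. ?\<kappa> A * \<gamma> {} A)"
      by (simp add: sum_distrib_left algebra_simps)
    also have "\<dots> \<le> opt_Pi I * 1"
      using that opt_ge_1 by (intro mult_left_mono) (auto simp: transport_plans_def)
    finally show ?thesis by simp
  qed
  obtain A where A: "A \<in> ?S" "?g A = opt_Pi I" "?\<kappa> A = 1" using optimal_scenario .
  \<comment> \<open>All mass moves to an optimal scenario; its distance 1 uses up the budget
    exactly.\<close>
  let ?\<gamma> = "\<lambda>_ A'. if A' = A then 1 else 0 :: real"
  have sums: "(\<Sum>A'\<in>?S. ?\<gamma> {} A') = 1" "(\<Sum>A'\<in>?S. ?\<kappa> A' * ?\<gamma> {} A') = 1"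
    "(\<Sum>A'\<in>?S. ?\<gamma> {} A' * ?g A') = opt_Pi I"
    using A finite_scenarios by (simp_all add: if_distrib[of "\<lambda>x. _ * x"] if_distrib[of "\<lambda>x. x * _"]
        cong: if_cong)
  have "?\<gamma> \<in> ?T" using sums by (simp add: transport_plans_def)
  then show ?thesis
    unfolding worst_case_def using sums(3) le
    by (intro cSup_eq_maximum) (auto intro!: image_eqI[of _ _ ?\<gamma>])
qed

end

section \<open>The three hardness claims for a class of instances\<close>

theorem theorem3p12:
  fixes s :: setting
    and D :: "bool list set"
    and inst :: "bool list \<Rightarrow> two_stage"
    and Z :: "bool list \<Rightarrow> real"
  assumes "\<And>w. w \<in> D \<Longrightarrow> finite (ground (inst w))"
    and "\<And>w. w \<in> D \<Longrightarrow> 1 \<le> card_bound (inst w)"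
    and "\<And>w. w \<in> D \<Longrightarrow> zero_decision \<in> decisions (inst w)"
    and "\<And>w x A. w \<in> D \<Longrightarrow> x \<in> decisions (inst w) \<Longrightarrow> A \<subseteq> ground (inst w) \<Longrightarrow>
           0 \<le> recourse (inst w) x A"
    and "poly_size_values D inst"
    and "\<And>w. s = B2 \<Longrightarrow> w \<in> D \<Longrightarrow> recourse (inst w) zero_decision (ground (inst w)) \<le> Z w / 2"
    and "\<And>w A. s = B2 \<Longrightarrow> w \<in> D \<Longrightarrow> A \<subseteq> ground (inst w) \<Longrightarrow>
           recourse (inst w) zero_decision A \<le> recourse (inst w) zero_decision (ground (inst w))"
    and "\<And>w. w \<in> D \<Longrightarrow> recourse (inst w) zero_decision {} = 0"
    and "NP_hard (Pi_yes D inst) (Pi_no D inst)"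
    and "\<And>w. w \<in> D \<Longrightarrow> 1 \<le> opt_Pi (inst w)"
    and "class_P \<noteq> class_NP"
  shows "\<not> approximable (penalized_problem s D inst Z) \<and>
    (\<exists>ps. valid_central D inst ps \<and> \<not> approximable (expectation_problem s D inst Z ps)) \<and>
    (\<exists>ps r. valid_central D inst ps \<and>
       (\<forall>w\<in>D. is_frac (fst (r w)) (snd (r w)) \<and> 0 < frac_val (fst (r w)) (snd (r w))) \<and>
       at_least_as_hard (worst_case_problem s D inst Z ps r) (Pi_problem D inst))"
proof -
  have inst: "robust_instance s (inst w) (Z w)" if w: "w \<in> D" for w
  proof
    show "finite (ground (inst w))" "recourse (inst w) zero_decision {} = 0" "1 \<le> opt_Pi (inst w)"
      using assms w by auto
    show "0 \<le> recourse (inst w) zero_decision A" if "A \<subseteq> ground (inst w)" for A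
      using assms(3,4) w that by blast
    \<comment> \<open>The bound given for the full ground set passes to all scenarios, because in
      \<open>B2\<close> no scenario costs more than the ground set.\<close>
    show "recourse (inst w) zero_decision A \<le> Z w / 2" if "s = B2" "A \<subseteq> ground (inst w)" for A
      using assms(6,7) w that order_trans by blast
  qed
  have frac_nonneg: "0 \<le> frac_val u v" for u v by (simp add: frac_val_def)
  note nonneg = robust_instance.penalized_nonneg[OF inst]
  note pos_iff = robust_instance.penalized_pos_iff[OF inst frac_nonneg]
  note core = not_approximable_if_positive_iff_below_opt[OF assms(1,5,9,10,11)]
  have "\<not> approximable (penalized_problem s D inst Z)"
    by (rule core[where c = "[]"]) (simp_all add: penalized_problem_def nonneg pos_iff)
  moreover have "\<not> approximable (expectation_problem s D inst Z (\<lambda>_. point_mass))"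
    by (rule core[where c = "enc_list [enc_dist point_mass]"])
      (simp_all add: expectation_problem_def nonneg pos_iff)
  moreover have "at_least_as_hard
      (worst_case_problem s D inst Z (\<lambda>_. point_mass) (\<lambda>_. ([True], [True]))) (Pi_problem D inst)"
  proof -
    \<comment> \<open>The code of an instance is a fixed prefix, consisting of the distribution and
      the radius 1/1, followed by the block of \<open>w\<close>.\<close>
    let ?f = "\<lambda>w. enc_list [enc_dist point_mass, [True], [True]] @ enc_list [w]"
    have "polytime_on UNIV ?f"
      by (rule polytime_on_comp[OF polytime_enc polytime_append]) simp
    then have "polytime_on D ?f" by (rule polytime_on_subset) simp
    then show ?thesis
      unfolding at_least_as_hard_def
      by (intro exI[of _ ?f]) (auto simp: worst_case_problem_def Pi_problem_def
          robust_instance.worst_case_point_mass[OF inst])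
  qed
  ultimately show ?thesis
    using valid_central_point_mass[of D inst]
    by (intro conjI exI[of _ "\<lambda>_. point_mass"] exI[of _ "\<lambda>_. ([True], [True])"])
      (auto simp: is_frac_def)
qed

end
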